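(* Let $n \ge 3$ be odd. Then the arc set $C_n$ defined in the context is a Hamilton cycle of the directed $\sigma$-$\tau$ graph $\Gamma_n$; that is, $C_n$ is the arc set of a single directed cycle of $\Gamma_n$ passing through all $n!$ vertices.
   Context: A permutation of $\{1,\dots,n\}$ is written as a string $\mathbf{p}=p_0p_1\cdots p_{n-1}$ in which each symbol of $\{1,\dots,n\}$ appears once. For such a string, $\mathbf{p}\sigma = p_1p_2\cdots p_{n-1}p_0$ (rotate left), $\mathbf{p}\sigma^{-1}=p_{n-1}p_0p_1\cdots p_{n-2}$, and $\mathbf{p}\tau = p_1p_0p_2\cdots p_{n-1}$ (swap the first two symbols). The directed $\sigma$-$\tau$ graph $\Gamma_n$ has the $n!$ permutation strings as vertices and arc set $\mathcal{E}_\sigma\cup\mathcal{E}_\tau$, where $\mathcal{E}_\sigma=\{(\mathbf{p},\mathbf{p}\sigma)\}$ and $\mathcal{E}_\tau=\{(\mathbf{p},\mathbf{p}\tau)\}$. Definition of $C_n$: for each vertex $\mathbf{p}=p_0\cdots p_{n-1}$ exactly one arc entering $\mathbf{p}$ is put in $C_n$, as follows. Let $i$ be the index with $p_i=n$ and let $r=p_{(i \bmod n-1)+1}$ (so $r$ is the symbol right of $n$, except $r=p_1$ when $i=n-1$). Then $(\mathbf{p}\tau,\mathbf{p})\in C_n$ if (a) $r<n-1$ and $r=p_0-1$, or (b) $r=n-1$ and $p_0=2$, or (c) $p_1p_2\cdots p_{n-1}$ is a cyclic rotation of $1\,2\,\cdots\,n{-}1$; otherwise $(\mathbf{p}\sigma^{-1},\mathbf{p})\in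 C_n$.
   Formalization: The theorem is proved for odd n ≥ 5 rather than odd n ≥ 3: for n = 3 the arc set C_3 as defined consists of two disjoint cycles, one of them 231 → 321 → 231, so the claim is false there. *)

theory Defs
  imports
    "HOL-Combinatorics.Multiset_Permutations"
    "Graph_Theory.Graph_Theory"
begin

text \<open>
  A permutation string over \<open>{1..n}\<close> is a list, indexed from \<open>0\<close>, in
  \<open>permutations_of_set {1..n}\<close>.
\<close>

definition sigma :: "nat list \<Rightarrow> nat list" where
  "sigma p = rotate1 p"

definition sigma_inv :: "nat list \<Rightarrow> nat list" where
  "sigma_inv p = last p # butlast p"

definition tau :: "nat list \<Rightarrow> nat list" where
  "tau p = p ! 1 # p ! 0 # drop 2 p"

definition sigma_tau_graph :: "nat \<Rightarrow> nat list pair_pre_digraph" where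
  "sigma_tau_graph n =
    \<lparr> pverts = permutations_of_set {1..n},
      parcs = {(p, sigma p) | p. p \<in> permutations_of_set {1..n}}
            \<union> {(p, tau p) | p. p \<in> permutations_of_set {1..n}} \<rparr>"

definition right_symbol :: "nat \<Rightarrow> nat list \<Rightarrow> nat" where
  "right_symbol n p = (let i = (THE i. i < n \<and> p ! i = n) in p ! (i mod (n - 1) + 1))"

text \<open>
  The condition under which the arc of \<open>C n\<close> entering \<open>p\<close> is a \<open>tau\<close>-arc.  In the first
  disjunct, \<open>r + 1 = p ! 0\<close> states \<open>r = p\<^sub>0 - 1\<close> without truncated subtraction.
\<close>

definition tau_cond :: "nat \<Rightarrow> nat list \<Rightarrow> bool" where
  "tau_cond n p \<longleftrightarrow>
    (let r = right_symbol n p in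
      (r < n - 1 \<and> r + 1 = p ! 0)
    \<or> (r = n - 1 \<and> p ! 0 = 2)
    \<or> (\<exists>k. tl p = rotate k [1..<n]))"

definition C :: "nat \<Rightarrow> (nat list \<times> nat list) set" where
  "C n = {(if tau_cond n p then tau p else sigma_inv p, p) | p. p \<in> permutations_of_set {1..n}}"

text \<open>
  \<open>pre_digraph.cycle\<close> speaks about a nonempty closed walk, given by its list of arcs, that
  lies in the graph and repeats no vertex except for its end point; the tails of these arcs are
  the vertices it visits.
\<close>

definition Hamilton_cycle :: "('a, 'b) pre_digraph \<Rightarrow> 'b set \<Rightarrow> bool" where
  "Hamilton_cycle G A \<longleftrightarrow>
    (\<exists>p. pre_digraph.cycle G p \<and> set p = A \<and> tail G ` set p = verts G)"

text \<open>
  For \<open>n = 3\<close> the arcs of \<open>C n\<close> form two disjoint cycles, of lengths 4 and 2, the latter on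
  the vertices \<open>231\<close> and \<open>321\<close>; so \<open>C 3\<close> is not a Hamilton cycle.
\<close>

lemma cas_closed:
  assumes "pre_digraph.cas G u p v" "u \<in> S"
    and "\<And>e. e \<in> set p \<Longrightarrow> tail G e \<in> S \<Longrightarrow> head G e \<in> S"
  shows "tail G ` set p \<subseteq> S"
  using assms
  by (induction p arbitrary: u) (auto simp: pre_digraph.cas.simps)

lemma right_symbol_eq:
  assumes "distinct p" "length p = n" "i < n" "p ! i = n"
  shows "right_symbol n p = p ! (i mod (n - 1) + 1)"
proof -
  have "(THE i. i < n \<and> p ! i = n) = i"
    using assms by (intro the_equality) (auto, metis nth_eq_iff_index_eq)
  then show ?thesis
    by (simp add: right_symbol_def)
qed

lemma tau_cond_3:
  "tau_cond 3 [2, 3, 1]" "tau_cond 3 [3, 2, 1]" "tau_cond 3 [2, 1, 3]" "tau_cond 3 [3, 1, 2]"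
  "\<not> tau_cond 3 [1, 2, 3]" "\<not> tau_cond 3 [1, 3, 2]"
proof -
  have rot: "(\<exists>k. xs = rotate k [1::nat, 2]) \<longleftrightarrow> xs = [1, 2] \<or> xs = [2, 1]" for xs
  proof
    assume "\<exists>k. xs = rotate k [1::nat, 2]"
    then obtain k where k: "xs = rotate k [1::nat, 2]" ..
    have "rotate k [1::nat, 2] = rotate (k mod 2) [1, 2]"
      using rotate_conv_mod[of k "[1::nat, 2]"] by (simp add: numeral_2_eq_2)
    moreover have "k mod 2 = 0 \<or> k mod 2 = 1" by auto
    ultimately show "xs = [1, 2] \<or> xs = [2, 1]" using k by auto
  next
    assume "xs = [1, 2] \<or> xs = [2, 1]"
    moreover have "[1::nat, 2] = rotate 0 [1, 2]" "[2::nat, 1] = rotate 1 [1, 2]" by auto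
    ultimately show "\<exists>k. xs = rotate k [1::nat, 2]" by blast
  qed
  have upt: "[1..<3] = [1::nat, 2]" by (simp add: upt_rec)
  note cond = tau_cond_def Let_def upt rot
  have "right_symbol 3 [2, 3, 1] = 1" by (subst right_symbol_eq[where i = 1]) simp_all
  then show "tau_cond 3 [2, 3, 1]" unfolding cond by simp
  have "right_symbol 3 [3, 2, 1] = 2" by (subst right_symbol_eq[where i = 0]) simp_all
  then show "tau_cond 3 [3, 2, 1]" unfolding cond by simp
  have "right_symbol 3 [2, 1, 3] = 1" by (subst right_symbol_eq[where i = 2]) simp_all
  then show "tau_cond 3 [2, 1, 3]" unfolding cond by simp
  have "right_symbol 3 [3, 1, 2] = 1" by (subst right_symbol_eq[where i = 0]) simp_all
  then show "tau_cond 3 [3, 1, 2]" unfolding cond by simp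
  have "right_symbol 3 [1, 2, 3] = 2" by (subst right_symbol_eq[where i = 2]) simp_all
  then show "\<not> tau_cond 3 [1, 2, 3]" unfolding cond by simp
  have "right_symbol 3 [1, 3, 2] = 2" by (subst right_symbol_eq[where i = 1]) simp_all
  then show "\<not> tau_cond 3 [1, 3, 2]" unfolding cond by simp
qed

lemma perms_3:
  "permutations_of_set {1..3::nat} =
    {[1, 2, 3], [1, 3, 2], [2, 1, 3], [2, 3, 1], [3, 1, 2], [3, 2, 1]}" (is "_ = ?P")
proof -
  have "{1..3::nat} = {1, 2, 3}" by auto
  then have "?P \<subseteq> permutations_of_set {1..3}"
    by (simp add: permutations_of_set_def insert_commute)
  moreover have "card ?P = card (permutations_of_set {1..3::nat})"
    by (simp add: fact_numeral)
  ultimately show ?thesis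
    by (metis card_subset_eq finite_permutations_of_set)
qed

lemma C_3:
  "C 3 = {([3, 1, 2], [1, 2, 3]), ([2, 1, 3], [1, 3, 2]), ([1, 2, 3], [2, 1, 3]),
          ([3, 2, 1], [2, 3, 1]), ([1, 3, 2], [3, 1, 2]), ([2, 3, 1], [3, 2, 1])}"
proof -
  have "C 3 = (\<lambda>p. (if tau_cond 3 p then tau p else sigma_inv p, p)) ` permutations_of_set {1..3}"
    unfolding C_def by blast
  then show ?thesis
    unfolding perms_3 by (simp only: image_insert image_empty tau_cond_3 if_True if_False)
      (simp add: tau_def sigma_inv_def)
qed

lemma not_Hamilton_cycle_C_3: "\<not> Hamilton_cycle (with_proj (sigma_tau_graph 3)) (C 3)"
proof
  let ?G = "with_proj (sigma_tau_graph 3)"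
  let ?S = "{[2, 3, 1], [3, 2, 1]} :: nat list set"
  assume "Hamilton_cycle ?G (C 3)"
  then obtain u p where cas: "pre_digraph.cas ?G u p u" and p: "set p = C 3"
    unfolding Hamilton_cycle_def pre_digraph.cycle_def pre_digraph.awalk_def by blast
  have step: "fst e \<in> ?S \<longleftrightarrow> snd e \<in> ?S" if "e \<in> C 3" for e
    using that unfolding C_3 by fastforce
  have tails: "[2, 3, 1] \<in> fst ` C 3" "[1, 2, 3] \<in> fst ` C 3"
    unfolding C_3 by simp_all
  show False
  proof (cases "u \<in> ?S")
    case True
    then have "fst ` C 3 \<subseteq> ?S"
      using cas_closed[OF cas, of ?S] step unfolding p with_proj_simps by blast
    then have "[1, 2, 3] \<in> ?S" using tails(2) by (rule subsetD)
    then show False by simp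
  next
    case False
    then have "fst ` C 3 \<subseteq> - ?S"
      using cas_closed[OF cas, of "- ?S"] step unfolding p with_proj_simps by blast
    then have "[2, 3, 1] \<in> - ?S" using tails(1) by (rule subsetD)
    then show False by simp
  qed
qed

end

theory Submission
  imports Defs "HOL-Combinatorics.Orbits"
begin

text \<open>
  \<open>C n\<close> contains exactly one arc into and one arc out of every vertex, so it is a disjoint union of
  cycles, and it remains to see that a function \<open>f\<close> on the vertices that is constant along the arcs
  is constant.

  Start from the cycles of \<open>\<sigma>\<close>, that is, from the cyclic permutations of \<open>1, \<dots>, n\<close>.  Rules (a) and
  (b) join all cyclic permutations that arise from a fixed one of the symbols other than \<open>x\<close>
  by inserting \<open>x\<close>, where \<open>x\<close> is the successor of the symbol to the right of \<open>n\<close> in the cyclic order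
  \<open>2, \<dots>, n - 1\<close> (with \<open>1\<close> sent to \<open>2\<close>).  Moving \<open>x\<close> directly behind \<open>n\<close> defines a map \<open>pull\<close> on the
  cyclic permutations; every orbit of it ends in the same cycle of length \<open>n - 2\<close>, the core.  On the
  rotation cycle of a cyclic permutation \<open>f\<close> takes at most two values, \<open>u\<close> and \<open>l\<close>, and the arcs of a
  join link the \<open>u\<close> and \<open>l\<close> of the words involved in a circular chain.  Outside of the core, the
  joins form trees, so \<open>u = l\<close> there, except on the paths that lead from the \<open>n - 1\<close> words affected by
  rule (c) to the core, along which \<open>u\<close> and \<open>l\<close> are transported unchanged.  Going once around the
  core therefore gives, for the words \<open>asc j\<close> of rule (c), the relation
  \<open>u (asc (j + 1)) = l (asc j) = u (asc (j - 1))\<close>, apart from a shift at \<open>j \<le> 2\<close> and \<open>j = n - 1\<close>.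
  For odd \<open>n\<close> these steps of length two reach every \<open>j\<close>.
\<close>


section \<open>Words and pulling\<close>

text \<open>The odd order 3 is a counterexample by \<open>not_Hamilton_cycle_C_3\<close>; parity
  enters from \<open>core_const\<close> on.\<close>

locale order_ge_5 =
  fixes n :: nat
  assumes n_ge_5: "n \<ge> 5"
begin

text \<open>Rules (a) and (b) together demand the first symbol \<open>nxt r\<close>. The map
  permutes \<open>{2..<n}\<close> cyclically, and 1 is a second preimage of 2.\<close>

definition nxt :: "nat \<Rightarrow> nat" where
  "nxt r = (if r = n - 1 then 2 else Suc r)"

definition words :: "nat list set" where
  "words = permutations_of_set {1..<n}"

text \<open>A word \<open>L\<close> stands for the cyclic permutation \<open>n # L\<close> up to rotation.  Rules (a) and (b)
  join all words that arise from \<open>L\<close> by moving the symbol \<open>nxt (hd L)\<close>; exactly one of them has this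
  symbol in front, and \<open>pull\<close> maps the others to it.\<close>

definition pull :: "nat list \<Rightarrow> nat list" where
  "pull L = nxt (hd L) # remove1 (nxt (hd L)) L"

text \<open>The words on the cycle of \<open>pull\<close>; \<open>core 1\<close> is a second name for \<open>core (n - 1)\<close>.\<close>

definition core :: "nat \<Rightarrow> nat list" where
  "core x = rev [2..<Suc x] @ rev [Suc x..<n] @ [1]"

definition Core :: "nat list set" where
  "Core = core ` {2..<n}"

text \<open>The rotations of \<open>1, \<dots>, n - 1\<close>, where rule (c) applies.\<close>

definition asc :: "nat \<Rightarrow> nat list" where
  "asc j = [Suc j..<n] @ [1..<Suc j]"

text \<open>The images of \<open>asc j\<close> under iterated pulling, listed by the symbol \<open>h\<close> that was pulled last: first
  \<open>h\<close> rises to \<open>n - 1\<close>, then it continues from \<open>2\<close>.  The first core word reached is \<open>path2 j j\<close>, but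
  for \<open>j = 1\<close> it is already \<open>path1 1 (n - 2)\<close>.\<close>

definition path1 :: "nat \<Rightarrow> nat \<Rightarrow> nat list" where
  "path1 j h = rev [Suc j..<Suc h] @ [Suc h..<n] @ [1..<Suc j]"

definition path2 :: "nat \<Rightarrow> nat \<Rightarrow> nat list" where
  "path2 j h = rev [2..<Suc h] @ rev [Suc j..<n] @ 1 # [Suc h..<Suc j]"

definition Path :: "nat \<Rightarrow> nat list set" where
  "Path j = (if j = 1 then path1 1 ` {2..<n - 2}
             else path1 j ` {j<..<n} \<union> path2 j ` {1..<j})"

declare upt_Suc [simp del]

lemma words_iff: "L \<in> words \<longleftrightarrow> distinct L \<and> set L = {1..<n}"
  by (auto simp: words_def permutations_of_set_def)

lemma words_length: "L \<in> words \<Longrightarrow> length L = n - 1"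
  by (auto simp: words_iff dest!: distinct_card)

lemma nxt_range: "r \<in> {1..<n} \<Longrightarrow> nxt r \<in> {2..<n}"
  using n_ge_5 by (auto simp: nxt_def)

lemma nxt_neq: "r \<in> {1..<n} \<Longrightarrow> nxt r \<noteq> r"
  using n_ge_5 by (auto simp: nxt_def)

lemma words_cases:
  assumes "L \<in> words"
  obtains r U V where "L = r # U @ nxt r # V" "nxt r \<in> {2..<n}" "r \<in> {1..<n}"
proof -
  have L: "set L = {1..<n}" using assms by (simp add: words_iff)
  then obtain r L' where r: "L = r # L'" using n_ge_5 by (cases L) auto
  then have r1: "r \<in> {1..<n}" using L by auto
  then have "nxt r \<in> set L" using nxt_range[OF r1] L by simp
  then have "nxt r \<in> set L'" using nxt_neq[OF r1] r by simp
  then show ?thesis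
    using that r nxt_range[OF r1] r1 by (metis split_list)
qed

lemma pull_split:
  assumes "distinct (r # U @ nxt r # V)"
  shows "pull (r # U @ nxt r # V) = nxt r # r # U @ V"
  using assms by (auto simp: pull_def remove1_append)

lemma pull_eq: "nxt (hd L) = x \<Longrightarrow> pull L = x # remove1 x L"
  by (simp add: pull_def)

lemma words_Cons: "L \<in> words \<Longrightarrow> L = hd L # tl L"
  by (erule words_cases) simp

lemma pull_words:
  assumes "L \<in> words"
  shows "pull L \<in> words"
proof -
  obtain r U V where "L = r # U @ nxt r # V" using assms by (rule words_cases)
  then show ?thesis using assms pull_split[of r U V] by (auto simp: words_iff)
qed

lemma pull_pow_words: "L \<in> words \<Longrightarrow> (pull ^^ k) L \<in> words"
  by (induction k) (auto simp: pull_words)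

lemma rev_upt_Cons: "a < b \<Longrightarrow> rev [a..<b] = (b - 1) # rev [a..<b - 1]"
  by (cases b) (auto simp: upt_Suc)

text \<open>The case \<open>x = 1\<close> is the wrap: the front symbol is then
  \<open>n - 1\<close>, which \<open>nxt\<close> sends to 2.\<close>

lemma pull_core:
  assumes "1 \<le> x" "Suc x < n"
  shows "pull (core x) = core (Suc x)"
proof -
  have hd: "nxt (hd (core x)) = Suc x"
  proof (cases "x = 1")
    case True
    then have "hd (core x) = n - 1" using n_ge_5 by (simp add: core_def rev_upt_Cons)
    then show ?thesis using True by (simp add: nxt_def)
  next
    case False
    then have "hd (core x) = x" using assms by (simp add: core_def rev_upt_Cons)
    then show ?thesis using assms by (simp add: nxt_def)
  qed
  have "[Suc x..<n] = Suc x # [Suc (Suc x)..<n]" using assms by (simp add: upt_conv_Cons)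
  then have "remove1 (Suc x) (core x) = rev [2..<Suc x] @ rev [Suc (Suc x)..<n] @ [1]"
    using assms by (auto simp: core_def remove1_append)
  then show ?thesis using assms by (subst pull_eq[OF hd]) (simp add: core_def rev_upt_Cons[of _ "Suc (Suc x)"])
qed

lemma core_1: "core 1 = core (n - 1)"
proof -
  have "Suc (n - 1) = n" "Suc 1 = 2" using n_ge_5 by simp_all
  then show ?thesis unfolding core_def by (simp only: upt_rec[of n n]) simp
qed

lemma hd_core: "2 \<le> x \<Longrightarrow> hd (core x) = x"
  by (simp add: core_def rev_upt_Cons)

lemma core_words: "1 \<le> x \<Longrightarrow> x < n \<Longrightarrow> core x \<in> words"
  by (auto simp: core_def words_iff)

lemma pull_Core:
  assumes "L \<in> Core"
  shows "pull L \<in> Core"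
proof -
  obtain x where x: "L = core x" "2 \<le> x" "x < n" using assms by (auto simp: Core_def)
  show ?thesis
  proof (cases "x = n - 1")
    case True
    then have "pull L = core 2"
      using pull_core[of 1] core_1 x n_ge_5 by (simp add: numeral_2_eq_2)
    then show ?thesis using n_ge_5 by (auto simp: Core_def)
  next
    case False
    then show ?thesis using pull_core[of x] x by (auto simp: Core_def)
  qed
qed

lemma pull_path1:
  assumes "1 \<le> j" "j < h" "Suc h < n"
  shows "pull (path1 j h) = path1 j (Suc h)"
proof -
  have hd: "nxt (hd (path1 j h)) = Suc h" using assms by (simp add: path1_def nxt_def rev_upt_Cons)
  have "[Suc h..<n] = Suc h # [Suc (Suc h)..<n]" using assms by (simp add: upt_conv_Cons)
  then have "remove1 (Suc h) (path1 j h) = rev [Suc j..<Suc h] @ [Suc (Suc h)..<n] @ [1..<Suc j]"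
    using assms by (auto simp: path1_def remove1_append)
  then show ?thesis using assms by (subst pull_eq[OF hd]) (simp add: path1_def rev_upt_Cons[of _ "Suc (Suc h)"])
qed

lemma path1_last: "2 \<le> j \<Longrightarrow> Suc j < n \<Longrightarrow> path1 j (n - 1) = path2 j 1"
proof -
  assume "2 \<le> j" "Suc j < n"
  moreover from this have "[1..<Suc j] = 1 # [Suc 1..<Suc j]" by (intro upt_conv_Cons) auto
  moreover have "[2..<Suc 1] = []" by simp
  moreover have "Suc (n - 1) = n" using n_ge_5 by simp
  ultimately show ?thesis unfolding path1_def path2_def by simp
qed

lemma path2_self: "path2 j j = core j"
  by (simp add: path2_def core_def)

lemma hd_path2:
  "1 \<le> h \<Longrightarrow> h < j \<Longrightarrow> j < n \<Longrightarrow> hd (path2 j h) = (if 2 \<le> h then h else if Suc j < n then n - 1 else 1)"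
  by (auto simp: path2_def rev_upt_Cons)

lemma hd_path1: "j < h \<Longrightarrow> hd (path1 j h) = h"
  by (simp add: path1_def rev_upt_Cons)

lemma pull_path2:
  assumes "1 \<le> h" "h < j" "j < n"
  shows "pull (path2 j h) = path2 j (Suc h)"
proof -
  have hd: "nxt (hd (path2 j h)) = Suc h"
    using hd_path2[OF assms] assms n_ge_5 by (auto simp: nxt_def)
  have "[Suc h..<Suc j] = Suc h # [Suc (Suc h)..<Suc j]" using assms by (simp add: upt_conv_Cons)
  then have "remove1 (Suc h) (path2 j h) = rev [2..<Suc h] @ rev [Suc j..<n] @ 1 # [Suc (Suc h)..<Suc j]"
    using assms by (auto simp: path2_def remove1_append)
  then show ?thesis using assms by (subst pull_eq[OF hd]) (simp add: path2_def rev_upt_Cons[of _ "Suc (Suc h)"])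
qed

text \<open>The ascending run has shrunk to length one and equals its reverse, so the path is
  already in the core here.\<close>

lemma path1_1: "path1 1 (n - 2) = core (n - 2)"
proof -
  have "Suc (n - 2) = n - 1" "[n - 1..<n] = [n - 1]" using n_ge_5 by (auto simp: upt_conv_Cons)
  then show ?thesis using n_ge_5 by (simp add: path1_def core_def numeral_2_eq_2 upt_Suc)
qed

text \<open>Pulling all of \<open>r + 1, \<dots>, n - 1, 2, \<dots>, r\<close> to the front, one after the other, leaves a
  descending cyclic run followed by \<open>1\<close>.\<close>

lemma pull_pow_up:
  assumes "L \<in> words" "hd L = r" "r + k < n"
  shows "(pull ^^ k) L = rev [Suc r..<Suc (r + k)] @ filter (\<lambda>y. y \<notin> {r<..r + k}) L"
  using assms(3)
proof (induction k)
  case (Suc k)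
  let ?F = "filter (\<lambda>y. y \<notin> {r<..r + k}) L"
  have L: "distinct L"
    using assms by (simp add: words_iff)
  obtain L' where L': "L = r # L'"
    using assms words_Cons by metis
  have "hd (rev [Suc r..<Suc (r + k)] @ ?F) = r + k"
    by (cases k) (simp_all add: rev_upt_Cons L')
  then have x: "nxt (hd ((pull ^^ k) L)) = Suc (r + k)"
    using Suc by (auto simp: nxt_def)
  have "remove1 (Suc (r + k)) ?F = filter (\<lambda>y. y \<notin> {r<..r + Suc k}) L"
    using L by (auto simp: distinct_remove1_removeAll removeAll_filter_not_eq intro!: filter_cong)
  then have "remove1 (Suc (r + k)) (rev [Suc r..<Suc (r + k)] @ ?F)
      = rev [Suc r..<Suc (r + k)] @ filter (\<lambda>y. y \<notin> {r<..r + Suc k}) L"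
    by (subst remove1_append) (simp del: upt_Suc)
  moreover have "(pull ^^ k) L = rev [Suc r..<Suc (r + k)] @ ?F"
    using Suc by simp
  ultimately show ?case
    using pull_eq[OF x] by (simp add: rev_upt_Cons[of _ "Suc (Suc (r + k))"])
qed simp

text \<open>With first symbol \<open>r\<close>, \<open>n - 1 - r\<close> pulls exhaust the symbols
  above \<open>r\<close> and \<open>r - 1\<close> more move \<open>2, ..., r\<close>; that is
  \<open>n - 2\<close> in all and leaves \<open>core r\<close>.\<close>

lemma pull_pow_Core:
  assumes "L \<in> words"
  shows "(pull ^^ (n - 2)) L \<in> Core"
proof -
  obtain r where r: "hd L = r" "r \<in> {1..<n}"
    using assms by (metis words_cases list.sel(1))
  define L1 where "L1 = (pull ^^ (n - 1 - r)) L"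
  have L1: "L1 = rev [Suc r..<n] @ filter (\<lambda>y. y \<le> r) L" "L1 \<in> words"
  proof -
    have "filter (\<lambda>y. y \<notin> {r<..n - 1}) L = filter (\<lambda>y. y \<le> r) L"
      using assms by (intro filter_cong) (auto simp: words_iff)
    then show "L1 = rev [Suc r..<n] @ filter (\<lambda>y. y \<le> r) L"
      using pull_pow_up[OF assms, of r "n - 1 - r"] r unfolding L1_def by auto
  qed (simp add: L1_def pull_pow_words assms)
  have L: "distinct L" "set L = {1..<n}"
    using assms by (simp_all add: words_iff)
  obtain L' where L': "L = r # L'"
    using assms r words_Cons by metis
  have up: "(pull ^^ k) L1 = rev [2..<Suc (Suc k)] @ rev [Suc r..<n]
      @ filter (\<lambda>y. y = 1 \<or> y > Suc k \<and> y \<le> r) L" if "Suc k \<le> r" for k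
    using that
  proof (induction k)
    case 0
    have "filter (\<lambda>y. y \<le> r) L = filter (\<lambda>y. y = 1 \<or> y > Suc 0 \<and> y \<le> r) L"
      using L r by (intro filter_cong) auto
    then show ?case using L1 by (auto simp: numeral_2_eq_2)
  next
    case (Suc k)
    let ?F = "filter (\<lambda>y. y = 1 \<or> y > Suc k \<and> y \<le> r) L"
    have x: "nxt (hd ((pull ^^ k) L1)) = Suc (Suc k)"
    proof (cases k)
      \<comment> \<open>The front symbol is \<open>n - 1\<close> in both cases: it was pulled last,
        or it is \<open>r\<close> itself because nothing was pulled.\<close>
      case 0
      show ?thesis
      proof (cases "Suc r = n")
        case True
        then show ?thesis
          using 0 L1(1) r n_ge_5 by (simp add: nxt_def L')
      next
        case False
        then show ?thesis
          using 0 L1(1) r by (auto simp: nxt_def rev_upt_Cons)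
      qed
    next
      case (Suc k')
      then show ?thesis using Suc.IH Suc.prems r by (simp add: nxt_def rev_upt_Cons)
    qed
    have "remove1 (Suc (Suc k)) ?F = filter (\<lambda>y. y = 1 \<or> y > Suc (Suc k) \<and> y \<le> r) L"
      using L(1) by (auto simp: distinct_remove1_removeAll removeAll_filter_not_eq intro!: filter_cong)
    then have "remove1 (Suc (Suc k)) (rev [2..<Suc (Suc k)] @ rev [Suc r..<n] @ ?F)
      = rev [2..<Suc (Suc k)] @ rev [Suc r..<n] @ filter (\<lambda>y. y = 1 \<or> y > Suc (Suc k) \<and> y \<le> r) L"
      using Suc.prems by (auto simp: remove1_append simp del: upt_Suc)
    moreover have "(pull ^^ k) L1 = rev [2..<Suc (Suc k)] @ rev [Suc r..<n] @ ?F"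
      using Suc by simp
    ultimately show ?case
      using pull_eq[OF x] by (simp add: rev_upt_Cons[of _ "Suc (Suc (Suc k))"])
  qed
  have "filter (\<lambda>y. y = 1 \<or> y > Suc (r - 1) \<and> y \<le> r) L = filter (\<lambda>y. y = 1) L"
    using r by (intro filter_cong) auto
  also have "\<dots> = [1]"
  proof -
    have "1 \<in> set L" using L n_ge_5 by simp
    then obtain A B where "L = A @ 1 # B" by (metis split_list)
    moreover from this have "filter (\<lambda>y. y = 1) A = []" "filter (\<lambda>y. y = 1) B = []"
      using L(1) by (auto simp: filter_empty_conv)
    ultimately show ?thesis by simp
  qed
  finally have "(pull ^^ (r - 1)) L1 = core r"
    using up[of "r - 1"] r by (auto simp: core_def)
  moreover have "(pull ^^ (n - 2)) L = (pull ^^ (r - 1)) L1"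
    unfolding L1_def using r n_ge_5 by (simp flip: funpow_add o_apply[of "pull ^^ _"])
  ultimately show ?thesis
    using r core_1 n_ge_5 by (cases "r = 1") (auto simp: Core_def)
qed

subsection \<open>Paths into the core\<close>

lemma path1_words: "1 \<le> j \<Longrightarrow> j < h \<Longrightarrow> h < n \<Longrightarrow> path1 j h \<in> words"
  by (auto simp: path1_def words_iff)

lemma path2_words: "1 \<le> h \<Longrightarrow> h \<le> j \<Longrightarrow> j < n \<Longrightarrow> path2 j h \<in> words"
  by (auto simp: path2_def words_iff)

lemma Path_words: "L \<in> Path j \<Longrightarrow> j \<in> {1..<n} \<Longrightarrow> L \<in> words"
  by (auto simp: Path_def intro!: path1_words path2_words split: if_splits)

lemma last_path1: "1 \<le> j \<Longrightarrow> last (path1 j h) = j"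
  by (simp add: path1_def)

lemma last_path2: "h < j \<Longrightarrow> last (path2 j h) = j"
  by (simp add: path2_def)

lemma last_Path: "L \<in> Path j \<Longrightarrow> j \<in> {1..<n} \<Longrightarrow> last L = j"
  by (auto simp: Path_def last_path1 last_path2 split: if_splits)

lemma last_core: "last (core x) = 1"
  by (simp add: core_def)

lemma asc_eq_path1: "asc j = path1 j (Suc j)" if "Suc j < n"
  using that by (simp add: asc_def path1_def upt_conv_Cons)

lemma asc_eq_path2: "asc (n - 1) = path2 (n - 1) 1"
proof -
  have "Suc (n - 1) = n" "Suc 1 = 2" using n_ge_5 by auto
  moreover have "[1..<n] = 1 # [2..<n]"
    using n_ge_5 upt_conv_Cons[of 1 n] by (simp add: numeral_2_eq_2)
  ultimately show ?thesis unfolding asc_def path2_def by (simp add: numeral_2_eq_2)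
qed

lemma asc_Path:
  assumes "j \<in> {1..<n}"
  shows "asc j \<in> Path j"
proof (cases "j = n - 1")
  case True
  then show ?thesis using asc_eq_path2 n_ge_5 by (auto simp: Path_def)
next
  case False
  then show ?thesis using asc_eq_path1[of j] assms n_ge_5 by (auto simp: Path_def)
qed

lemma Path_cases:
  assumes "L \<in> Path j" "j \<noteq> 1"
  obtains h where "L = path1 j h" "j < h" "h < n"
    | h where "L = path2 j h" "2 \<le> h" "h < j"
    | "L = path2 j 1"
proof -
  from assms consider h where "L = path1 j h" "j < h" "h < n"
    | h where "L = path2 j h" "1 \<le> h" "h < j"
    by (auto simp: Path_def)
  then show ?thesis
  proof cases
    case (2 h)
    then show ?thesis using that by (cases "h = 1") auto
  qed (use that in blast)
qed

lemma asc_words: "j \<in> {1..<n} \<Longrightarrow> asc j \<in> words"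
  using asc_Path Path_words by blast

lemma path1_Path: "j \<noteq> 1 \<Longrightarrow> j < h \<Longrightarrow> h < n \<Longrightarrow> path1 j h \<in> Path j"
  by (simp add: Path_def)

lemma path2_Path: "1 \<le> h \<Longrightarrow> h < j \<Longrightarrow> path2 j h \<in> Path j"
  by (simp add: Path_def)

text \<open>Each path is one chain under \<open>pull\<close> starting at \<open>asc j\<close>: the
  preimage lowers the last pulled symbol, crossing from \<open>path2\<close> to \<open>path1\<close>
  at \<open>path2 j 1\<close>.\<close>

lemma Path_pull_source:
  assumes "L \<in> Path j" "j \<in> {1..<n}" "L \<noteq> asc j"
  shows "\<exists>L'\<in>Path j. pull L' = L"
proof -
  have shift: "\<exists>L'\<in>Path j. pull L' = path1 j h"
    if "j < h" "h < n" "path1 j h \<noteq> asc j" "path1 j (h - 1) \<in> Path j \<or> h = Suc j" for h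
  proof -
    have "h \<noteq> Suc j" using that asc_eq_path1 by auto
    then show ?thesis
      using that pull_path1[of j "h - 1"] assms(2) by (intro bexI[of _ "path1 j (h - 1)"]) auto
  qed
  show ?thesis
  proof (cases "j = 1")
    case True
    then obtain h where "L = path1 1 h" "2 \<le> h" "h < n - 2"
      using assms by (auto simp: Path_def)
    moreover from this have "path1 1 (h - 1) \<in> Path 1 \<or> h = Suc 1"
      by (cases "h = 2") (auto simp: Path_def intro!: imageI)
    ultimately show ?thesis using shift[of h] assms True by simp
  next
    case False
    from assms(1) False show ?thesis
    proof (cases rule: Path_cases)
      case (1 h)
      then have "path1 j (h - 1) \<in> Path j \<or> h = Suc j"
        using path1_Path[of j "h - 1"] False by auto
      then show ?thesis using shift[of h] assms 1 by simp
    next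
      case (2 h)
      then show ?thesis
        using pull_path2[of "h - 1" j] assms(2) False
        by (intro bexI[of _ "path2 j (h - 1)"] path2_Path) auto
    next
      case 3
      then have "Suc j < n" using assms asc_eq_path2 by (cases "j = n - 1") auto
      moreover have "L = path1 j (n - 1)" using 3 path1_last assms False \<open>Suc j < n\<close> by auto
      moreover have "path1 j (n - 2) \<in> Path j \<or> n - 1 = Suc j"
        using path1_Path[of j "n - 2"] False \<open>Suc j < n\<close> by auto
      moreover have "n - 1 - 1 = n - 2" by simp
      ultimately show ?thesis using shift[of "n - 1"] assms by simp
    qed
  qed
qed

text \<open>Pulling raises the parameter \<open>h\<close> by one; only at the end of the range is
  the path left, and there the word has become a core word.\<close>

lemma Path_pull:
  assumes "L \<in> Path j" "j \<in> {1..<n}"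
  shows "pull L \<in> Path j \<or> j \<noteq> 1 \<and> L = path2 j (j - 1) \<and> pull L = core j
    \<or> j = 1 \<and> pull L = core (n - 2)"
proof (cases "j = 1")
  case True
  then obtain h where h: "L = path1 1 h" "2 \<le> h" "h < n - 2"
    using assms by (auto simp: Path_def)
  then have p: "pull L = path1 1 (Suc h)" using pull_path1[of 1 h] by auto
  show ?thesis
  proof (cases "Suc h = n - 2")
    case True
    then show ?thesis using p path1_1 \<open>j = 1\<close> by simp
  next
    case False
    then show ?thesis using p h \<open>j = 1\<close> by (auto simp: Path_def)
  qed
next
  case False
  from assms(1) False consider h where "L = path1 j h" "j < h" "h < n"
    | h where "L = path2 j h" "1 \<le> h" "h < j"
    by (auto simp: Path_def)
  then show ?thesis
  proof cases
    case (1 h)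
    show ?thesis
    proof (cases "Suc h = n")
      case True
      then have "h = n - 1" by simp
      show ?thesis
      proof (cases "Suc j < n")
        case True
        then have L: "L = path2 j 1" using path1_last[of j] 1 \<open>h = n - 1\<close> False assms by auto
        then have p: "pull L = path2 j (Suc 1)" using pull_path2[of 1 j] assms False by auto
        show ?thesis
        proof (cases "j = 2")
          case True
          then show ?thesis using p L path2_self[of 2] by (simp add: numeral_2_eq_2)
        next
          case False
          then have "Suc 1 < j" using assms \<open>j \<noteq> 1\<close> by auto
          then show ?thesis using p \<open>j \<noteq> 1\<close> by (auto simp: Path_def)
        qed
      qed (use 1 in auto)
    next
      case False
      then show ?thesis using 1 pull_path1[of j h] assms \<open>j \<noteq> 1\<close> by (auto simp: Path_def)
    qed
  next
    case (2 h)
    then have p: "pull L = path2 j (Suc h)" using pull_path2[of h j] assms by auto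
    show ?thesis
    proof (cases "Suc h = j")
      case True
      then show ?thesis using p 2 path2_self[of j] False by auto
    next
      case neq: False
      then show ?thesis using p 2 False by (auto simp: Path_def)
    qed
  qed
qed

text \<open>For \<open>j > 1\<close> the first symbols along the path are
  \<open>j + 1, ..., n - 1, 2, ..., j - 1\<close>, preceded by 1 if \<open>j = n - 1\<close>; none
  recurs.\<close>

lemma Path_hd_inject:
  assumes "L \<in> Path j" "L' \<in> Path j" "hd L = hd L'" "j \<in> {1..<n}"
  shows "L = L'"
proof (cases "j = 1")
  case True
  then show ?thesis using assms by (auto simp: Path_def hd_path1)
next
  case False
  have wlog: "(j < hd K \<and> K = path1 j (hd K))
      \<or> (hd K \<le> j \<and> 2 \<le> hd K \<and> K = path2 j (hd K))
      \<or> (hd K = 1 \<and> K = path2 j 1)" if "K \<in> Path j" for K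
  proof -
    from that False show ?thesis
    proof (cases rule: Path_cases)
      case 3
      show ?thesis
      proof (cases "Suc j < n")
        case True
        then have "K = path1 j (n - 1)" "hd K = n - 1"
          using path1_last[of j] 3 assms False hd_path2[of 1 j] by auto
        then show ?thesis using True by auto
      next
        case neq: False
        then show ?thesis using 3 assms False hd_path2[of 1 j] by auto
      qed
    next
      case (2 h)
      then show ?thesis using hd_path2[of h j] assms by auto
    qed (auto simp: hd_path1)
  qed
  show ?thesis using wlog[OF assms(1)] wlog[OF assms(2)] assms(3,4) by auto
qed

text \<open>Last symbols leave only \<open>j = 1\<close>; equal first symbols then force the
  ascending run above \<open>h\<close>, of length at least two, to equal its reverse.\<close>

lemma Path_Core: "L \<in> Path j \<Longrightarrow> j \<in> {1..<n} \<Longrightarrow> L \<notin> Core"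
proof
  assume L: "L \<in> Path j" "j \<in> {1..<n}" "L \<in> Core"
  then obtain x where x: "L = core x" "2 \<le> x" "x < n" by (auto simp: Core_def)
  then have "j = 1" using last_Path[OF L(1,2)] last_core by simp
  then obtain h where h: "L = path1 1 h" "2 \<le> h" "h < n - 2"
    using L by (auto simp: Path_def)
  then have "h = x" using x hd_core[of x] hd_path1[of 1 h] by simp
  then have "[Suc h..<n] = rev [Suc h..<n]"
    using x h by (simp add: core_def path1_def numeral_2_eq_2 upt_Suc)
  then have "hd [Suc h..<n] = hd (rev [Suc h..<n])" by simp
  then show False using h by (auto simp: rev_upt_Cons)
qed

section \<open>Injectivity on the core and the fibres of \<open>pull\<close>\<close>

lemma core_inject:
  assumes "core x = core y" "2 \<le> x" "2 \<le> y"
  shows "x = y"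
  using assms hd_core by metis

lemma Core_pull_eq:
  assumes "L \<in> Core" "pull L = core x" "2 \<le> x" "x < n"
  shows "L = core (x - 1)"
proof -
  obtain y where y: "L = core y" "2 \<le> y" "y < n" using assms by (auto simp: Core_def)
  show ?thesis
  proof (cases "y = n - 1")
    case True
    then have "pull L = core 2"
      using pull_core[of 1] core_1 y n_ge_5 by (simp add: numeral_2_eq_2)
    then have "x = 2" using core_inject assms by auto
    then show ?thesis using y True core_1 by simp
  next
    case False
    then have "pull L = core (Suc y)" using pull_core[of y] y by auto
    then have "x = Suc y" using core_inject[of x "Suc y"] assms y by auto
    then show ?thesis using y by simp
  qed
qed

text \<open>For a word \<open>x # r # W\<close> with \<open>x = nxt r\<close> this is the fibre of
  \<open>pull\<close> over it; \<open>i\<close> counts the symbols between \<open>r\<close> and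
  \<open>x\<close>, and values above \<open>length W\<close> repeat the last word.\<close>

definition ins :: "nat \<Rightarrow> nat \<Rightarrow> nat list \<Rightarrow> nat \<Rightarrow> nat list" where
  "ins x r W i = r # take i W @ x # drop i W"

lemma ins_words: "x # r # W \<in> words \<Longrightarrow> ins x r W i \<in> words"
proof -
  assume a: "x # r # W \<in> words"
  have "mset (ins x r W i) = mset (x # r # W)"
    by (simp add: ins_def) (metis append_take_drop_id mset_append union_commute)
  then show ?thesis
    using a unfolding words_iff by (metis mset_eq_imp_distinct_iff mset_eq_setD)
qed

lemma pull_ins:
  assumes "x # r # W \<in> words" "x = nxt r"
  shows "pull (ins x r W i) = x # r # W"
proof -
  have "ins x r W i \<in> words" using ins_words assms by blast
  then show ?thesis
    using pull_split[of r "take i W" "drop i W"] assms by (auto simp: ins_def words_iff)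
qed

lemma pull_eqE:
  assumes "L \<in> words" "pull L = x # r # W"
  obtains i where "i \<le> length W" "L = ins x r W i" "x = nxt r"
proof -
  obtain r' U V where L: "L = r' # U @ nxt r' # V" using assms(1) by (rule words_cases)
  then have "x = nxt r'" "r' = r" "W = U @ V"
    using assms pull_split[of r' U V] by (auto simp: words_iff)
  then show ?thesis using that[of "length U"] L by (auto simp: ins_def)
qed

lemma ins_inject:
  assumes "x # r # W \<in> words" "ins x r W i = ins x r W k" "i \<le> length W" "k \<le> length W"
  shows "i = k"
proof -
  have *: "takeWhile (\<lambda>y. y \<noteq> x) (tl (ins x r W m)) = take m W" for m
  proof -
    have "\<forall>y\<in>set (take m W). y \<noteq> x"
      using assms(1) by (auto simp: words_iff dest: in_set_takeD)
    then show ?thesis by (simp add: ins_def)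
  qed
  have "take i W = take k W" using *[of i] *[of k] assms(2) by simp
  then show ?thesis using assms(3,4) by (metis length_take min.absorb2)
qed

end

section \<open>Invariants of the words\<close>

text \<open>\<open>u\<close> and \<open>l\<close> abstract the two values of an invariant on the
  rotation cycle of a word. The \<open>ins\<close> laws record the \<open>tau\<close>-arcs of a
  join, the \<open>asc\<close> laws those of rule (c); \<open>plain\<close> concerns rotation cycles
  that are cut at one place only.\<close>

locale arc_invariant = order_ge_5 +
  fixes u l :: "nat list \<Rightarrow> 'a"
  assumes plain: "\<lbrakk>a # b # W \<in> words; a \<noteq> nxt b; \<And>j. j \<in> {1..<n} \<Longrightarrow> a # b # W \<noteq> asc j\<rbrakk>
      \<Longrightarrow> u (a # b # W) = l (a # b # W)"
    and ins_first: "nxt r # r # W \<in> words \<Longrightarrow> l (nxt r # r # W) = l (r # nxt r # W)"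
    and ins_step: "r # U @ v # nxt r # V \<in> words
      \<Longrightarrow> l (r # U @ v # nxt r # V) = u (r # U @ nxt r # v # V)"
    and ins_last: "nxt r # r # W \<in> words \<Longrightarrow> u (nxt r # r # W) = u (r # W @ [nxt r])"
    and asc_step: "\<lbrakk>1 \<le> j; Suc j < n\<rbrakk> \<Longrightarrow> u (asc (Suc j)) = l (asc j)"
    and asc_wrap: "u (asc 1) = l (asc (n - 1))"
begin

text \<open>The join as a circular chain: each fibre word is entered at \<open>l\<close> and left at
  \<open>u\<close>, and the pulled word \<open>x # r # W\<close> closes the circle.\<close>

lemma ins_chain:
  assumes "x # r # W \<in> words" "x = nxt r"
  shows "l (x # r # W) = l (ins x r W 0)"
    and "i < length W \<Longrightarrow> l (ins x r W (Suc i)) = u (ins x r W i)"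
    and "u (x # r # W) = u (ins x r W (length W))"
proof -
  show "l (x # r # W) = l (ins x r W 0)" using assms ins_first[of r W] by (simp add: ins_def)
  show "u (x # r # W) = u (ins x r W (length W))"
    using assms ins_last[of r W] by (simp add: ins_def)
  assume i: "i < length W"
  have "ins x r W (Suc i) = r # take i W @ W ! i # nxt r # drop (Suc i) W"
    using i assms by (simp add: ins_def take_Suc_conv_app_nth)
  moreover have "ins x r W i = r # take i W @ nxt r # W ! i # drop (Suc i) W"
    using i assms by (simp add: ins_def Cons_nth_drop_Suc)
  ultimately show "l (ins x r W (Suc i)) = u (ins x r W i)"
    using ins_step[of r "take i W" "W ! i"] ins_words[OF assms(1), of "Suc i"] by simp
qed

lemma ins_chain_interval:
  assumes "x # r # W \<in> words" "x = nxt r" "a \<le> b" "b \<le> length W"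
    and "\<And>i. a \<le> i \<Longrightarrow> i < b \<Longrightarrow> u (ins x r W i) = l (ins x r W i)"
  shows "l (ins x r W b) = l (ins x r W a)"
  using assms(3-5)
proof (induction rule: dec_induct)
  case (step i)
  then show ?case using ins_chain(2)[OF assms(1,2), of i] by auto
qed simp

text \<open>Induction invariant for the trees outside the core. The last symbol of a word on path
  \<open>j\<close> is \<open>j\<close>, so at most one \<open>j\<close> applies.\<close>

definition tame :: "nat list \<Rightarrow> bool" where
  "tame L \<longleftrightarrow> (\<forall>j\<in>{1..<n}. L \<in> Path j \<longrightarrow> u L = u (asc j) \<and> l L = l (asc j))
    \<and> ((\<forall>j\<in>{1..<n}. L \<notin> Path j) \<longrightarrow> u L = l L)"

lemma tame_asc: "j \<in> {1..<n} \<Longrightarrow> tame (asc j)"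
  using asc_Path last_Path unfolding tame_def by metis

text \<open>Two lists that are pulled to the same list differ in the position of one symbol only, and at
  most one of them is on a path: the last entry determines the path and the first entry the
  position on it.\<close>

lemma tame_pull:
  assumes Q: "Q \<in> words" "Q \<notin> Core"
    and IH: "\<And>L. L \<in> words \<Longrightarrow> pull L = Q \<Longrightarrow> tame L"
  shows "tame Q"
proof (cases "\<exists>j\<in>{1..<n}. Q = asc j")
  case True
  then show ?thesis using tame_asc by blast
next
  case not_asc: False
  obtain x r W where Qe: "Q = x # r # W"
    using words_length[OF Q(1)] n_ge_5 by (cases Q; cases "tl Q") auto
  show ?thesis
  proof (cases "x = nxt r")
    case False
    \<comment> \<open>Such a word is a leaf with empty fibre, whereas a path word other than
      \<open>asc j\<close> has a preimage on its path.\<close>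
    have "Q \<notin> Path j" if j: "j \<in> {1..<n}" for j
    proof
      assume "Q \<in> Path j"
      then obtain L' where "L' \<in> Path j" "pull L' = Q"
        using Path_pull_source[of Q j] not_asc j by blast
      then show False using pull_eqE Path_words j Qe False by metis
    qed
    then show ?thesis
      using plain[of x r W] Q Qe False not_asc unfolding tame_def by blast
  next
    case x: True
    note Q' = Q(1)[unfolded Qe]
    have w: "ins x r W i \<in> words" "pull (ins x r W i) = Q" for i
      using ins_words[OF Q'] pull_ins[OF Q' x] Qe by auto
    have t: "tame (ins x r W i)" for i using IH[OF w] .
    have up: "Q \<in> Path j" if "ins x r W i \<in> Path j" "j \<in> {1..<n}" for i j
      using Path_pull[OF that] w(2)[of i] Q(2) that(2) n_ge_5 unfolding Core_def by force
    show ?thesis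
    proof (cases "\<exists>j\<in>{1..<n}. Q \<in> Path j")
      case True
      then obtain j where j: "j \<in> {1..<n}" "Q \<in> Path j" by blast
      then obtain L' where L': "L' \<in> Path j" "pull L' = Q"
        using Path_pull_source[of Q j] not_asc by blast
      then obtain k where k: "k \<le> length W" "L' = ins x r W k"
        using pull_eqE[of L' x r W] Path_words j Qe by metis
      have plain_i: "u (ins x r W i) = l (ins x r W i)" if "i \<noteq> k" "i \<le> length W" for i
      proof -
        have "ins x r W i \<notin> Path j'" if j': "j' \<in> {1..<n}" for j'
        proof
          assume a: "ins x r W i \<in> Path j'"
          then have "j' = j" using up[OF a j'] j j' last_Path by metis
          then have "ins x r W i = ins x r W k"
            using Path_hd_inject[of "ins x r W i" j "ins x r W k"] a L' k j by (simp add: ins_def)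
          then show False using ins_inject[OF Q'] \<open>i \<noteq> k\<close> \<open>i \<le> length W\<close> k by blast
        qed
        then show ?thesis using t[of i] unfolding tame_def by blast
      qed
      \<comment> \<open>The path word at position \<open>k\<close> cuts the chain: one piece joins
        its \<open>l\<close> to \<open>l Q\<close>, the other its \<open>u\<close> to
        \<open>u Q\<close>.\<close>
      have "l (ins x r W k) = l Q"
        using ins_chain_interval[OF Q' x, of 0 k] plain_i k ins_chain(1)[OF Q' x] Qe by auto
      moreover have "u (ins x r W k) = u Q"
      proof (cases "k = length W")
        case True
        then show ?thesis using ins_chain(3)[OF Q' x] Qe by simp
      next
        case False
        then have "l (ins x r W (length W)) = l (ins x r W (Suc k))"
          using ins_chain_interval[OF Q' x, of "Suc k" "length W"] plain_i k by auto
        then show ?thesis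
          using ins_chain(2)[OF Q' x, of k] ins_chain(3)[OF Q' x] plain_i[of "length W"] False k Qe
          by auto
      qed
      moreover have "u (ins x r W k) = u (asc j)" "l (ins x r W k) = l (asc j)"
        using t[of k] L' k j unfolding tame_def by auto
      moreover have "j' = j" if "j' \<in> {1..<n}" "Q \<in> Path j'" for j'
        using that j last_Path by metis
      ultimately show ?thesis using j unfolding tame_def by metis
    next
      case False
      then have plain_i: "u (ins x r W i) = l (ins x r W i)" for i
        using t[of i] up unfolding tame_def by blast
      have "u Q = l Q"
        using ins_chain_interval[OF Q' x, of 0 "length W"] plain_i ins_chain(1,3)[OF Q' x] Qe by auto
      then show ?thesis using False unfolding tame_def by blast
    qed
  qed
qed

lemma pull_pow_mem_Core: "L \<in> Core \<Longrightarrow> (pull ^^ k) L \<in> Core"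
  by (induction k) (auto simp: pull_Core)

text \<open>Induction from the words farthest from the core inwards: a preimage needs one pull more,
  and by \<open>pull_pow_Core\<close> none needs more than \<open>n - 2\<close>.\<close>

lemma tame_depth:
  assumes "L \<in> words" "(pull ^^ (n - 2 - d)) L \<notin> Core"
  shows "tame L"
  using assms
proof (induction d arbitrary: L)
  case 0
  then show ?case using pull_pow_Core by simp
next
  case (Suc d)
  show ?case
  proof (cases "n - 2 - d = 0")
    case True
    then show ?thesis using Suc by simp
  next
    case False
    then have k: "n - 2 - d = Suc (n - 2 - Suc d)" by simp
    show ?thesis
    proof (rule tame_pull)
      show "tame L'" if "L' \<in> words" "pull L' = L" for L'
        using Suc.IH[of L'] Suc.prems that unfolding k by (simp add: funpow_swap1)
    qed (use Suc.prems pull_pow_mem_Core in auto)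
  qed
qed

lemma tame: "L \<in> words \<Longrightarrow> L \<notin> Core \<Longrightarrow> tame L"
  using tame_depth[of L "n - 2"] by simp

lemma tame_Path: "L \<in> Path j \<Longrightarrow> j \<in> {1..<n} \<Longrightarrow> u L = u (asc j) \<and> l L = l (asc j)"
  using tame Path_words Path_Core unfolding tame_def by blast

text \<open>In the fibre over \<open>core x\<close>, \<open>core (x - 1)\<close> and the last word
  of path \<open>x\<close> hold the last two positions, with \<open>x\<close> just before or just
  after 1. For \<open>x = n - 2\<close> the last word of path 1 lies earlier in the chain; on the
  rest of the fibre \<open>u\<close> and \<open>l\<close> agree.\<close>

lemma core_relations:
  assumes x: "2 \<le> x" "x < n"
  shows "u (core x) = u (asc x)"
    and "l (asc x) = u (core (x - 1))"
    and "x \<noteq> n - 2 \<Longrightarrow> l (core x) = l (core (x - 1))"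
    and "x = n - 2 \<Longrightarrow> l (core x) = l (asc 1) \<and> u (asc 1) = l (core (x - 1))"
proof -
  define A where "A = rev [2..<x] @ rev [Suc x..<n]"
  have rx: "rev [x..<n] = rev [Suc x..<n] @ [x]" using x by (simp add: upt_conv_Cons)
  have "length A = n - 3" using x by (simp add: A_def)
  then obtain r W' where A: "A = r # W'" using n_ge_5 by (cases A) auto
  let ?W = "W' @ [1]"
  have Sx: "Suc (x - 1) = x" using x by simp
  have core_x: "core x = x # r # ?W" using x A by (simp add: core_def A_def rev_upt_Cons)
  have "core (x - 1) = A @ [x, 1]"
    unfolding core_def Sx by (simp add: A_def rx)
  then have core_x1: "core (x - 1) = ins x r ?W (length W')"
    by (simp add: ins_def A)
  have "path2 x (x - 1) = A @ [1, x]"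
    unfolding path2_def Sx by (simp add: A_def upt_conv_Cons)
  then have path_x: "path2 x (x - 1) = ins x r ?W (length ?W)"
    by (simp add: ins_def A)
  have Q: "x # r # ?W \<in> words" using core_words[of x] core_x x by auto
  have "pull (core (x - 1)) = x # r # ?W"
    using pull_core[of "x - 1"] x core_x by simp
  then have nx: "x = nxt r"
    using pull_eqE[of "core (x - 1)" x r ?W] core_words[of "x - 1"] x by auto
  have w: "ins x r ?W i \<in> words" "pull (ins x r ?W i) = core x" for i
    using ins_words[OF Q] pull_ins[OF Q nx] core_x by auto
  have pPath: "path2 x (x - 1) \<in> Path x" using x by (auto simp: Path_def)
  then have tp: "u (path2 x (x - 1)) = u (asc x)" "l (path2 x (x - 1)) = l (asc x)"
    using tame_Path[of "path2 x (x - 1)" x] x by auto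
  show "u (core x) = u (asc x)"
    using ins_chain(3)[OF Q nx] core_x path_x tp by simp
  show "l (asc x) = u (core (x - 1))"
    using ins_chain(2)[OF Q nx, of "length W'"] core_x1 path_x tp by simp
  have plain_i: "u (ins x r ?W i) = l (ins x r ?W i)"
    if i: "i < length W'" and n2: "x = n - 2 \<Longrightarrow> ins x r ?W i \<notin> Path 1" for i
  proof -
    let ?L = "ins x r ?W i"
    have "?L \<noteq> core (x - 1)" using ins_inject[OF Q, of i "length W'"] i core_x1 by auto
    then have nC: "?L \<notin> Core" using Core_pull_eq[of ?L x] w x by blast
    have "?L \<notin> Path j" if j: "j \<in> {1..<n}" for j
    proof
      assume a: "?L \<in> Path j"
      have "core x \<notin> Path j" using Path_Core[of "core x" j] j x by (auto simp: Core_def)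
      then consider "?L = path2 j (j - 1)" "core x = core j" "j \<noteq> 1" | "j = 1" "core x = core (n - 2)"
        using Path_pull[OF a j] w by auto
      then show False
      proof cases
        case 1
        then have "j = x" using core_inject[of x j] x j by auto
        then show False using 1 path_x ins_inject[OF Q, of i "length ?W"] i by auto
      next
        case 2
        then show False using core_inject[of x "n - 2"] x n_ge_5 n2 a by auto
      qed
    qed
    then show ?thesis using tame[OF w(1) nC] unfolding tame_def by blast
  qed
  show "l (core x) = l (core (x - 1))" if "x \<noteq> n - 2"
    using ins_chain_interval[OF Q nx, of 0 "length W'"] ins_chain(1)[OF Q nx] plain_i core_x core_x1
      that by auto
  show "l (core x) = l (asc 1) \<and> u (asc 1) = l (core (x - 1))" if x2: "x = n - 2"
  proof -
    let ?L = "path1 1 (n - 3)"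
    have L: "?L \<in> Path 1" using n_ge_5 by (auto simp: Path_def intro!: imageI)
    have "Suc (n - 3) = n - 2" using n_ge_5 by simp
    then have "pull ?L = core x" using pull_path1[of 1 "n - 3"] path1_1 x2 n_ge_5 by simp
    then obtain k where k: "k \<le> length ?W" "?L = ins x r ?W k"
      using pull_eqE[of ?L x r ?W] Path_words[OF L] core_x n_ge_5 by auto
    have "k \<noteq> length ?W"
      using k path_x last_Path[OF L] last_Path[OF pPath] x n_ge_5 by auto
    moreover have "k \<noteq> length W'"
    proof
      assume "k = length W'"
      then have "?L = core (x - 1)" using k core_x1 by simp
      then show False using Path_Core[OF L] x2 n_ge_5 by (auto simp: Core_def)
    qed
    ultimately have kW: "k < length W'" using k by auto
    have pl: "u (ins x r ?W i) = l (ins x r ?W i)" if "i < length W'" "i \<noteq> k" for i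
    proof (rule plain_i[OF that(1)])
      show "ins x r ?W i \<notin> Path 1"
      proof
        assume a: "ins x r ?W i \<in> Path 1"
        have "hd (ins x r ?W i) = hd ?L" unfolding k(2) by (simp add: ins_def)
        then have "ins x r ?W i = ins x r ?W k"
          using Path_hd_inject[OF a L] n_ge_5 k(2) by simp
        then show False using ins_inject[OF Q, of i k] k(1) that by simp
      qed
    qed
    have t: "u ?L = u (asc 1)" "l ?L = l (asc 1)" using tame_Path[OF L] n_ge_5 by auto
    \<comment> \<open>The word of path 1 splits the segment of the chain between
      \<open>core x\<close> and \<open>core (x - 1)\<close>.\<close>
    have "l ?L = l (core x)"
      using ins_chain_interval[OF Q nx, of 0 k] pl kW ins_chain(1)[OF Q nx] core_x k by auto
    moreover have "u ?L = l (core (x - 1))"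
      using ins_chain_interval[OF Q nx, of "Suc k" "length W'"] ins_chain(2)[OF Q nx, of k]
        pl kW core_x1 k by auto
    ultimately show ?thesis using t by simp
  qed
qed

text \<open>The relations link \<open>u (core x)\<close> to \<open>u (core (x + 2))\<close>; only for odd \<open>n\<close> do the steps of two on
  the cycle of the \<open>n - 2\<close> core lists reach all of them.\<close>

lemma core_const:
  assumes "odd n"
  shows "\<And>x. x \<in> {2..<n} \<Longrightarrow> u (asc x) = u (asc 2)"
    and "u (asc 1) = u (asc 2)"
    and "\<And>x. x \<in> {1..<n} \<Longrightarrow> l (asc x) = u (asc 2)"
    and "\<And>x. x \<in> {2..<n} \<Longrightarrow> u (core x) = u (asc 2) \<and> l (core x) = u (asc 2)"
proof -
  have a: "u (asc (Suc x)) = u (asc (x - 1))" if "3 \<le> x" "Suc x < n" for x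
    using asc_step[of x] core_relations(2)[of x] core_relations(1)[of "x - 1"] that by auto
  have lx: "l (asc x) = u (asc (x - 1))" if "3 \<le> x" "x < n" for x
    using core_relations(2)[of x] core_relations(1)[of "x - 1"] that by auto
  have l2: "l (asc 2) = u (asc (n - 1))"
    using core_relations(2)[of 2] core_relations(1)[of "n - 1"] core_1 n_ge_5 by simp
  \<comment> \<open>The step through \<open>core 1 = core (n - 1)\<close> links 3 with
    \<open>n - 1\<close>; for odd \<open>n\<close> this ties the odd indices to the even
    ones.\<close>
  have a3: "u (asc 3) = u (asc (n - 1))"
    using asc_step[of 2] l2 n_ge_5 by (simp add: numeral_3_eq_3 numeral_2_eq_2)
  have par: "u (asc (2 + 2 * k)) = u (asc 2)" if "2 + 2 * k < n" for k
    using that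
  proof (induction k)
    case (Suc k)
    then show ?case using a[of "3 + 2 * k"] by (auto simp: eval_nat_numeral)
  qed simp
  have odd: "u (asc (3 + 2 * k)) = u (asc 3)" if "3 + 2 * k < n" for k
    using that
  proof (induction k)
    case (Suc k)
    then show ?case using a[of "4 + 2 * k"] by (auto simp: eval_nat_numeral)
  qed simp
  have "even (n - 1)" "n - 1 \<ge> 2" using assms n_ge_5 by auto
  then obtain k where "n - 1 = 2 + 2 * k"
    by (metis add_diff_inverse_nat dvd_diff_nat dvd_refl evenE not_less)
  then have "u (asc (n - 1)) = u (asc 2)" using par[of k] n_ge_5 by simp
  then have a32: "u (asc 3) = u (asc 2)" using a3 by simp
  show all: "u (asc x) = u (asc 2)" if x: "x \<in> {2..<n}" for x
  proof (cases "even x")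
    case True
    then obtain k where "x = 2 + 2 * k"
      using x by (metis atLeastLessThan_iff dvd_diff_nat dvd_refl evenE le_add_diff_inverse)
    then show ?thesis using par[of k] x by simp
  next
    case False
    then obtain m where m: "x = 2 * m + 1" by (elim oddE)
    with x have "x = 3 + 2 * (m - 1)" by (cases m) auto
    then show ?thesis using odd[of "m - 1"] a32 x by simp
  qed
  have c: "l (core x) = l (core 1)" if "x + 3 \<le> n" "1 \<le> x" for x
    using that(2,1)
  proof (induction rule: dec_induct)
    case (step x)
    then show ?case using core_relations(3)[of "Suc x"] by auto
  qed simp
  have u1: "u (asc 1) = l (asc (n - 1))" by (rule asc_wrap)
  then show u1': "u (asc 1) = u (asc 2)"
    using lx[of "n - 1"] all[of "n - 2"] n_ge_5 by (simp add: numeral_2_eq_2)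
  have c1: "l (core (n - 1)) = l (core (n - 2))"
    using core_relations(3)[of "n - 1"] n_ge_5 by (simp add: numeral_2_eq_2)
  have c2: "l (core (n - 2)) = l (asc 1)" "u (asc 1) = l (core (n - 3))"
    using core_relations(4)[of "n - 2"] n_ge_5 by (auto simp: numeral_2_eq_2 numeral_3_eq_3)
  \<comment> \<open>Around the core: \<open>l (asc 1) = l (core (n - 2)) = l (core (n - 1)) = l
    (core 1) = l (core (n - 3)) = u (asc 1)\<close>.\<close>
  have l1: "l (asc 1) = u (asc 2)"
    using c[of "n - 3"] c1 c2 core_1 u1' n_ge_5 by simp
  show "l (asc x) = u (asc 2)" if x: "x \<in> {1..<n}" for x
  proof -
    consider "x = 1" | "x = 2" | "3 \<le> x" using x by fastforce
    then show ?thesis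
    proof cases
      case 3
      then have "x - 1 \<in> {2..<n}" using x by auto
      then show ?thesis using lx[of x] all[of "x - 1"] 3 x by simp
    qed (use l1 l2 all[of "n - 1"] n_ge_5 in auto)
  qed
  show "u (core x) = u (asc 2) \<and> l (core x) = u (asc 2)" if "x \<in> {2..<n}" for x
  proof -
    have "x + 3 \<le> n \<or> x = n - 2 \<or> x = n - 1" using that by auto
    then have "l (core x) = u (asc 2)"
      using c[of x] c1 c2 l1 core_1 that by (auto simp: Suc_le_eq)
    then show ?thesis using core_relations(1)[of x] all[of x] that by auto
  qed
qed

lemma u_eq_l:
  assumes "odd n" "L \<in> words"
  shows "u L = l L"
proof (cases "L \<in> Core")
  case True
  then show ?thesis using core_const(4)[OF assms(1)] by (auto simp: Core_def)
next
  case False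
  have "u (asc j) = l (asc j)" if "j \<in> {1..<n}" for j
    using core_const(1)[OF assms(1), of j] core_const(2,3)[OF assms(1)] that
    by (cases "j = 1") auto
  then show ?thesis using tame[OF assms(2) False] unfolding tame_def by metis
qed

text \<open>With \<open>u = l\<close> on every word no chain is cut any more, so all words of a join
  share one value.\<close>

lemma u_pull:
  assumes "odd n" "L \<in> words"
  shows "u (pull L) = u L"
proof -
  have "length (pull L) = n - 1" using words_length pull_words assms by blast
  then obtain x r W where Q: "pull L = x # r # W"
    using n_ge_5 by (cases "pull L"; cases "tl (pull L)") auto
  then obtain i where i: "i \<le> length W" "L = ins x r W i" "x = nxt r"
    using pull_eqE assms by metis
  have Qw: "x # r # W \<in> words" using Q pull_words assms by metis
  have pl: "u (ins x r W i) = l (ins x r W i)" for i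
    using u_eq_l ins_words[OF Qw] assms by blast
  have "l (ins x r W i) = l (x # r # W)"
    using ins_chain_interval[OF Qw i(3), of 0 i] i pl ins_chain(1)[OF Qw i(3)] by auto
  then show ?thesis using i Q pl u_eq_l[OF assms(1) Qw] by simp
qed

lemma const:
  assumes "odd n" "L \<in> words"
  shows "u L = u (asc 2)" "l L = u (asc 2)"
proof -
  have "u ((pull ^^ k) L) = u L" for k
    by (induction k) (auto simp: u_pull assms pull_pow_words)
  moreover have "u ((pull ^^ (n - 2)) L) = u (asc 2)"
    using pull_pow_Core[OF assms(2)] core_const(4)[OF assms(1)] by (auto simp: Core_def)
  ultimately show "u L = u (asc 2)" by metis
  then show "l L = u (asc 2)" using u_eq_l assms by metis
qed

end

section \<open>Invariants of the vertices\<close>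

context order_ge_5
begin

section \<open>Rotations of a word and the rules on them\<close>

definition vertices :: "nat list set" where
  "vertices = permutations_of_set {1..n}"

text \<open>The rotation of \<open>n # L\<close> with first symbol \<open>L ! k\<close>, or
  \<open>n\<close> if \<open>k = length L\<close>. In this form \<open>sigma_inv\<close> lowers
  \<open>k\<close> by one.\<close>

definition place :: "nat list \<Rightarrow> nat \<Rightarrow> nat list" where
  "place L k = drop k L @ n # take k L"

lemma vertices_iff: "p \<in> vertices \<longleftrightarrow> distinct p \<and> set p = {1..n}"
  by (auto simp: vertices_def permutations_of_set_def)

lemma vertices_length: "p \<in> vertices \<Longrightarrow> length p = n"
  by (auto simp: vertices_iff dest!: distinct_card)

lemma insert_n: "insert n {1..<n} = {1..n}"
  using n_ge_5 by auto

lemma append_vertices_iff: "A @ n # B \<in> vertices \<longleftrightarrow> B @ A \<in> words"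
proof
  assume a: "A @ n # B \<in> vertices"
  then have "insert n (set (B @ A)) = insert n {1..<n}" "n \<notin> set (B @ A)" "distinct (B @ A)"
    unfolding insert_n by (auto simp: vertices_iff)
  then show "B @ A \<in> words"
    unfolding words_iff by (metis atLeastLessThan_iff insert_ident less_irrefl)
next
  assume a: "B @ A \<in> words"
  then have "set (A @ n # B) = insert n {1..<n}" by (auto simp: words_iff)
  then show "A @ n # B \<in> vertices"
    using a unfolding insert_n by (auto simp: vertices_iff words_iff)
qed

lemma place_vertices: "L \<in> words \<Longrightarrow> place L k \<in> vertices"
  by (simp add: place_def append_vertices_iff)

lemma vertices_place:
  assumes "p \<in> vertices"
  obtains L k where "L \<in> words" "k \<le> n - 1" "p = place L k"
proof -
  have "n \<in> set p" using assms n_ge_5 by (auto simp: vertices_iff)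
  then obtain A B where p: "p = A @ n # B" by (metis split_list)
  then have "B @ A \<in> words" using assms append_vertices_iff by simp
  moreover have "p = place (B @ A) (length B)" using p by (simp add: place_def)
  moreover have "length B \<le> n - 1" using vertices_length[OF assms] p by simp
  ultimately show ?thesis using that by blast
qed

lemma not_rotation: "n \<in> set xs \<Longrightarrow> xs \<noteq> rotate k [1..<n]"
  by auto

lemma right_symbol_inner:
  assumes "A @ n # b # B \<in> vertices"
  shows "right_symbol n (A @ n # b # B) = b"
proof -
  have len: "length (A @ n # b # B) = n" using vertices_length assms by blast
  then have "length A < n - 1" by simp
  then show ?thesis
    using right_symbol_eq[of "A @ n # b # B" n "length A"] assms len
    by (simp add: vertices_iff nth_append)
qed

lemma right_symbol_last:
  assumes "a # b # A @ [n] \<in> vertices"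
  shows "right_symbol n (a # b # A @ [n]) = b"
proof -
  have len: "length (a # b # A @ [n]) = n" using vertices_length assms by blast
  then have "(a # b # A @ [n]) ! (n - 1) = n" using nth_append_length[of "a # b # A" n "[]"]
    by (metis append_Cons diff_Suc_1 length_append_singleton)
  then show ?thesis
    using right_symbol_eq[of "a # b # A @ [n]" n "n - 1"] assms len n_ge_5
    by (simp add: vertices_iff)
qed

text \<open>The symbol \<open>n\<close> in the tail rules out (c); as \<open>b < n\<close>, rules
  (a) and (b) combine to \<open>nxt\<close>.\<close>

lemma tau_cond_inner:
  assumes "a # A @ n # b # B \<in> vertices"
  shows "tau_cond n (a # A @ n # b # B) \<longleftrightarrow> a = nxt b"
proof -
  have r: "right_symbol n (a # A @ n # b # B) = b"
    using right_symbol_inner[of "a # A" b B] assms by simp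
  have "b \<in> set (a # A @ n # b # B)" "b \<noteq> n" using assms by (auto simp: vertices_iff)
  then have "1 \<le> b" "b < n" using assms by (auto simp: vertices_iff)
  then show ?thesis
    using not_rotation[of "A @ n # b # B"] unfolding tau_cond_def Let_def r nxt_def by auto
qed

lemma tau_cond_last:
  assumes "a # b # A @ [n] \<in> vertices"
  shows "tau_cond n (a # b # A @ [n]) \<longleftrightarrow> a = nxt b"
proof -
  have r: "right_symbol n (a # b # A @ [n]) = b"
    using right_symbol_last assms by simp
  have "b \<in> set (a # b # A @ [n])" "b \<noteq> n" using assms by (auto simp: vertices_iff)
  then have "1 \<le> b" "b < n" using assms by (auto simp: vertices_iff)
  then show ?thesis
    using not_rotation[of "b # A @ [n]"] unfolding tau_cond_def Let_def r nxt_def by auto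
qed

text \<open>With \<open>n\<close> in front, (a) would need \<open>r = n - 1\<close> and (b)
  \<open>n = 2\<close>; only (c) is left.\<close>

lemma tau_cond_first:
  assumes "n # L \<in> vertices"
  shows "tau_cond n (n # L) \<longleftrightarrow> (\<exists>k. L = rotate k [1..<n])"
proof -
  have "length (n # L) = n" using vertices_length assms by blast
  then obtain b B where L: "L = b # B" using n_ge_5 by (cases L) auto
  then have r: "right_symbol n (n # L) = b"
    using right_symbol_inner[of "[]" b B] assms by simp
  then show ?thesis
    unfolding tau_cond_def Let_def r using n_ge_5 by auto
qed

lemma asc_eq_rotate: "j < n \<Longrightarrow> asc j = rotate j [1..<n]"
  by (cases "j = n - 1") (auto simp: asc_def rotate_drop_take drop_upt take_upt)

lemma rotation_iff_asc: "(\<exists>k. L = rotate k [1..<n]) \<longleftrightarrow> (\<exists>j\<in>{1..<n}. L = asc j)"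
proof
  assume "\<exists>k. L = rotate k [1..<n]"
  then obtain k where "L = rotate k [1..<n]" ..
  then have k: "L = rotate (k mod (n - 1)) [1..<n]" using rotate_conv_mod[of k "[1..<n]"] by simp
  have lt: "k mod (n - 1) < n - 1" using n_ge_5 by simp
  show "\<exists>j\<in>{1..<n}. L = asc j"
  proof (cases "k mod (n - 1) = 0")
    case True
    \<comment> \<open>The words \<open>asc\<close> are indexed from 1, so the trivial rotation is
      named by \<open>n - 1\<close>.\<close>
    then have "L = rotate (n - 1) [1..<n]" using k by simp
    then show ?thesis using asc_eq_rotate[of "n - 1"] n_ge_5 by (intro bexI[of _ "n - 1"]) auto
  next
    case False
    then show ?thesis using k lt asc_eq_rotate[of "k mod (n - 1)"]
      by (intro bexI[of _ "k mod (n - 1)"]) auto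
  qed
qed (auto simp: asc_eq_rotate)

lemma sigma_inv_append: "sigma_inv (q @ [c]) = c # q"
  by (simp add: sigma_inv_def)

lemma sigma_inv_place:
  assumes "k < length L"
  shows "sigma_inv (place L (Suc k)) = place L k"
proof -
  have "place L (Suc k) = (drop (Suc k) L @ n # take k L) @ [L ! k]"
    using assms by (simp add: place_def take_Suc_conv_app_nth)
  then have "sigma_inv (place L (Suc k)) = L ! k # drop (Suc k) L @ n # take k L"
    by (simp only: sigma_inv_append)
  then show ?thesis using assms by (simp add: place_def Cons_nth_drop_Suc[symmetric])
qed

lemma sigma_inv_place_0: "sigma_inv (place L 0) = place L (length L)"
  by (simp add: place_def sigma_inv_append)

text \<open>Here \<open>b\<close> is the cyclic successor of \<open>a\<close>. Hence rule (c) does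
  not coincide with a second cut at position 0.\<close>

lemma asc_not_ascent:
  assumes "j \<in> {1..<n}" "asc j = a # b # W"
  shows "a \<noteq> nxt b"
proof -
  have l: "length (asc j) = n - 1" using assms(1) by (simp add: asc_def)
  have a: "a = asc j ! 0" and b: "b = asc j ! 1" using assms by auto
  have "a = (if Suc j < n then Suc j else 1)"
    using assms n_ge_5 unfolding a by (auto simp: asc_def nth_append)
  moreover have "b = (if Suc (Suc j) < n then Suc (Suc j) else if Suc j < n then 1 else 2)"
    using assms n_ge_5 unfolding b by (auto simp: asc_def nth_append)
  ultimately show ?thesis using n_ge_5 by (auto simp: nxt_def split: if_splits)
qed

lemma tau_cond_place:
  assumes "L \<in> words" "1 \<le> k" "k < n - 1"
  shows "tau_cond n (place L k) \<longleftrightarrow> L ! k = nxt (L ! 0)"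
proof -
  have len: "length L = n - 1" using words_length assms by blast
  then obtain b X where L: "L = b # X" using assms by (cases L) auto
  have "place L k = L ! k # drop (Suc k) L @ n # b # take (k - 1) X"
    using assms len L by (cases k) (simp_all add: place_def Cons_nth_drop_Suc)
  moreover have "place L k \<in> vertices" using place_vertices assms by blast
  ultimately show ?thesis using tau_cond_inner L by simp
qed

lemma tau_cond_place_0:
  assumes "a # b # W \<in> words"
  shows "tau_cond n (place (a # b # W) 0) \<longleftrightarrow> a = nxt b"
  using tau_cond_last[of a b W] place_vertices[OF assms, of 0] by (simp add: place_def)

lemma tau_cond_place_all:
  assumes "L \<in> words"
  shows "tau_cond n (place L (n - 1)) \<longleftrightarrow> (\<exists>j\<in>{1..<n}. L = asc j)"
  using tau_cond_first[of L] place_vertices[OF assms, of "n - 1"] words_length[OF assms]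
    rotation_iff_asc[of L] by (simp add: place_def)

end

locale vertex_invariant = order_ge_5 +
  fixes f :: "nat list \<Rightarrow> 'a"
  assumes f_tau: "\<lbrakk>p \<in> vertices; tau_cond n p\<rbrakk> \<Longrightarrow> f (tau p) = f p"
    and f_sigma_inv: "\<lbrakk>p \<in> vertices; \<not> tau_cond n p\<rbrakk> \<Longrightarrow> f (sigma_inv p) = f p"
begin

lemma f_place_Suc:
  assumes "L \<in> words" "Suc k < n - 1" "L ! Suc k \<noteq> nxt (L ! 0)"
  shows "f (place L (Suc k)) = f (place L k)"
  using f_sigma_inv[OF place_vertices[OF assms(1)], of "Suc k"] assms tau_cond_place[of L "Suc k"]
    sigma_inv_place[of k L] words_length[OF assms(1)] by simp

lemma nth_words_inject:
  "L \<in> words \<Longrightarrow> i < n - 1 \<Longrightarrow> k < n - 1 \<Longrightarrow> L ! i = L ! k \<longleftrightarrow> i = k"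
  using words_length[of L] by (simp add: words_iff nth_eq_iff_index_eq)

text \<open>Among the positions 1 to \<open>n - 2\<close> only \<open>m\<close> is entered by a
  \<open>tau\<close>-arc; those below \<open>m\<close> share the value at 0, the others that at
  \<open>n - 2\<close>.\<close>

lemma f_place_low:
  assumes "L \<in> words" "L ! m = nxt (L ! 0)" "m < n - 1" "k < m"
  shows "f (place L k) = f (place L 0)"
  using assms(4)
proof (induction k)
  case (Suc k)
  then show ?case
    using f_place_Suc[OF assms(1), of k] nth_words_inject[OF assms(1), of "Suc k" m] assms by simp
qed simp

lemma f_place_high:
  assumes "L \<in> words" "L ! m = nxt (L ! 0)" "m \<le> k" "k < n - 1"
  shows "f (place L k) = f (place L (n - 2))"
proof -
  have "f (place L k) = f (place L m)" if "m \<le> k" "k < n - 1" for k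
    using that
  proof (induction rule: dec_induct)
    case (step k)
    then show ?case
      using f_place_Suc[OF assms(1), of k] nth_words_inject[OF assms(1), of "Suc k" m] assms by simp
  qed simp
  from this[of k] this[of "n - 2"] show ?thesis using assms by simp
qed

lemma f_place_all:
  assumes "L \<in> words" "\<And>j. j \<in> {1..<n} \<Longrightarrow> L \<noteq> asc j"
  shows "f (place L (n - 2)) = f (place L (n - 1))"
proof -
  have "\<not> tau_cond n (place L (n - 1))" using tau_cond_place_all assms by blast
  moreover have "sigma_inv (place L (n - 1)) = place L (n - 2)"
    using sigma_inv_place[of "n - 2" L] words_length[OF assms(1)] n_ge_5
    by (simp add: Suc_diff_Suc numeral_2_eq_2)
  ultimately show ?thesis using f_sigma_inv[OF place_vertices[OF assms(1)]] by metis
qed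

lemma f_place_0:
  assumes "a # b # W \<in> words" "a \<noteq> nxt b"
  shows "f (place (a # b # W) 0) = f (place (a # b # W) (n - 1))"
  using f_sigma_inv[OF place_vertices[OF assms(1)], of 0] tau_cond_place_0[OF assms(1)] assms
    sigma_inv_place_0[of "a # b # W"] words_length[OF assms(1)] by simp

text \<open>Swapping \<open>n\<close> and \<open>a\<close> in \<open>n # a # R\<close> yields a
  rotation of \<open>n # R @ [a]\<close>, which belongs to the next ascending word.\<close>

lemma f_rotate_asc:
  assumes "a # R \<in> words" "a # R = asc j" "j \<in> {1..<n}"
  shows "f (place (R @ [a]) (n - 2)) = f (place (a # R) 0)"
proof -
  obtain b W where R: "R = b # W" using words_length[OF assms(1)] n_ge_5 by (cases R) auto
  have len: "length R = n - 2" using words_length[OF assms(1)] by simp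
  have "f (place (a # R) 0) = f (place (a # R) (n - 1))"
    using f_place_0[of a b W] assms R asc_not_ascent[of j a b W] by simp
  also have "\<dots> = f (tau (place (a # R) (n - 1)))"
  proof -
    have "tau_cond n (place (a # R) (n - 1))" using tau_cond_place_all assms by blast
    then show ?thesis using f_tau[OF place_vertices[OF assms(1)]] by metis
  qed
  also have "place (a # R) (n - 1) = n # a # R" using len n_ge_5 by (simp add: place_def)
  also have "tau (n # a # R) = place (R @ [a]) (n - 2)" using len by (simp add: place_def tau_def)
  finally show ?thesis by simp
qed

text \<open>Positions 0 and \<open>n - 2\<close> lie on the two sides of the cut; position
  \<open>n - 1\<close> is linked to 0 for the words \<open>asc j\<close> and to \<open>n - 2\<close>
  for all others.\<close>

sublocale arc_invariant n "\<lambda>L. f (place L (n - 2))" "\<lambda>L. f (place L 0)"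
proof
  show "f (place (a # b # W) (n - 2)) = f (place (a # b # W) 0)"
    if "a # b # W \<in> words" "a \<noteq> nxt b" "\<And>j. j \<in> {1..<n} \<Longrightarrow> a # b # W \<noteq> asc j" for a b W
    using f_place_0 f_place_all that by simp
  show "f (place (nxt r # r # W) 0) = f (place (r # nxt r # W) 0)"
    if w: "nxt r # r # W \<in> words" for r W
    using f_tau[OF place_vertices[OF w], of 0] tau_cond_place_0[OF w]
    by (simp add: place_def tau_def)
  show "f (place (r # U @ v # nxt r # V) 0) = f (place (r # U @ nxt r # v # V) (n - 2))"
    if w: "r # U @ v # nxt r # V \<in> words" for r U v V
  proof -
    let ?L = "r # U @ nxt r # v # V" and ?L' = "r # U @ v # nxt r # V" and ?k = "Suc (length U)"
    have L: "?L \<in> words" using w by (auto simp: words_iff)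
    have k: "Suc ?k < n - 1" using words_length[OF w] by simp
    have nths: "?L ! ?k = nxt (?L ! 0)" "?L' ! Suc ?k = nxt (?L' ! 0)"
      by (simp_all add: nth_append)
    have "f (place ?L (n - 2)) = f (place ?L ?k)"
      using f_place_high[OF L nths(1), of ?k] k by simp
    also have "\<dots> = f (tau (place ?L ?k))"
      using f_tau[OF place_vertices[OF L], of ?k] tau_cond_place[OF L, of ?k] nths k by simp
    also have "tau (place ?L ?k) = place ?L' ?k" by (simp add: place_def tau_def)
    \<comment> \<open>After the swap \<open>nxt r\<close> stands one place later, so position
      \<open>?k\<close> now lies below the cut.\<close>
    also have "f (place ?L' ?k) = f (place ?L' 0)"
      using f_place_low[OF w nths(2), of ?k] k by simp
    finally show ?thesis by simp
  qed
  show "f (place (nxt r # r # W) (n - 2)) = f (place (r # W @ [nxt r]) (n - 2))"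
    if w: "nxt r # r # W \<in> words" for r W
  proof -
    let ?L = "r # W @ [nxt r]"
    have L: "?L \<in> words" using w by (auto simp: words_iff)
    have n2: "n - 2 = length (r # W)" and n1: "n - 1 = length (nxt r # r # W)"
      using words_length[OF w] by simp_all
    from n2 have "?L ! (n - 2) = nxt r" by (metis nth_append_length append_Cons length_Cons)
    then have "tau_cond n (place ?L (n - 2))" using tau_cond_place[OF L, of "n - 2"] n_ge_5 by simp
    then have "f (place ?L (n - 2)) = f (tau (place ?L (n - 2)))"
      using f_tau[OF place_vertices[OF L]] by simp
    also have "tau (place ?L (n - 2)) = place (nxt r # r # W) (n - 1)"
      unfolding n1 n2 by (simp add: place_def tau_def)
    also have "f \<dots> = f (place (nxt r # r # W) (n - 2))"
      using f_place_all[OF w] asc_not_ascent by metis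
    finally show ?thesis by simp
  qed
  show "f (place (asc (Suc j)) (n - 2)) = f (place (asc j) 0)" if "1 \<le> j" "Suc j < n" for j
  proof -
    have "asc j = Suc j # [Suc (Suc j)..<n] @ [1..<Suc j]"
      "asc (Suc j) = ([Suc (Suc j)..<n] @ [1..<Suc j]) @ [Suc j]"
      using that by (simp_all add: asc_def upt_conv_Cons upt_Suc)
    then show ?thesis using f_rotate_asc[of "Suc j" "[Suc (Suc j)..<n] @ [1..<Suc j]" j]
      asc_Path[of j] Path_words[of "asc j" j] that by simp
  qed
  show "f (place (asc 1) (n - 2)) = f (place (asc (n - 1)) 0)"
  proof -
    have "asc (n - 1) = 1 # [2..<n]" "asc 1 = [2..<n] @ [1]"
      using n_ge_5 by (simp_all add: asc_def upt_conv_Cons numeral_2_eq_2)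
    then show ?thesis using f_rotate_asc[of 1 "[2..<n]" "n - 1"]
      asc_Path[of "n - 1"] Path_words[of "asc (n - 1)" "n - 1"] n_ge_5 by simp
  qed
qed

lemma f_const:
  assumes "odd n" "p \<in> vertices"
  shows "f p = f (place (asc 2) (n - 2))"
proof -
  obtain L k where L: "L \<in> words" "k \<le> n - 1" "p = place L k"
    using assms(2) by (rule vertices_place)
  note c = const[OF assms(1) L(1)]
  obtain r U V where LU: "L = r # U @ nxt r # V" using L(1) by (rule words_cases)
  let ?m = "Suc (length U)"
  have m: "L ! ?m = nxt (L ! 0)" "?m < n - 1"
    using LU words_length[OF L(1)] by (simp_all add: nth_append)
  consider "k < ?m" | "?m \<le> k" "k < n - 1" | "k = n - 1" using L(2) by linarith
  then show ?thesis
  proof cases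
    case 1
    then show ?thesis using f_place_low[OF L(1) m] L(3) c by simp
  next
    case 2
    then show ?thesis using f_place_high[OF L(1) m(1)] L(3) c by simp
  next
    case 3
    show ?thesis
    proof (cases "\<exists>j\<in>{1..<n}. L = asc j")
      case True
      then obtain j where j: "j \<in> {1..<n}" "L = asc j" by blast
      obtain a b W where W: "L = a # b # W"
        using words_length[OF L(1)] n_ge_5 by (cases L; cases "tl L") auto
      then have "a \<noteq> nxt b" using asc_not_ascent j by metis
      then show ?thesis using f_place_0[of a b W] L 3 c W by simp
    next
      case False
      then show ?thesis using f_place_all[OF L(1)] L 3 c by auto
    qed
  qed
qed

end

section \<open>The Hamilton cycle\<close>

lemma cas_funpow:
  assumes "tail G = fst" "head G = snd" "a \<le> b"
  shows "pre_digraph.cas G ((h ^^ a) s) (map (\<lambda>i. ((h ^^ i) s, (h ^^ Suc i) s)) [a..<b]) ((h ^^ b) s)"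
  using assms(3)
proof (induction rule: inc_induct)
  case base
  then show ?case by (simp add: pre_digraph.cas.simps)
next
  case (step i)
  then show ?case using assms by (simp add: pre_digraph.cas.simps upt_conv_Cons)
qed

lemma awalk_verts_funpow:
  assumes "tail G = fst" "head G = snd" "a \<le> b"
  shows "pre_digraph.awalk_verts G ((h ^^ a) s) (map (\<lambda>i. ((h ^^ i) s, (h ^^ Suc i) s)) [a..<b])
    = map (\<lambda>i. (h ^^ i) s) [a..<Suc b]"
  using assms(3)
proof (induction rule: inc_induct)
  case base
  then show ?case by (simp add: pre_digraph.awalk_verts.simps)
next
  case (step i)
  then show ?case using assms by (simp add: pre_digraph.awalk_verts.simps upt_conv_Cons)
qed

lemma Hamilton_cycle_cyclic:
  assumes G: "tail G = fst" "head G = snd" "verts G = V"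
    and h: "cyclic_on h V" "inj_on h V"
    and A: "A = (\<lambda>p. (p, h p)) ` V" "A \<subseteq> arcs G"
  shows "Hamilton_cycle G A"
proof -
  obtain s where s: "s \<in> V" "V = orbit h s" using h(1) by (auto simp: cyclic_on_def)
  then have so: "s \<in> orbit h s" by simp
  define N where "N = funpow_dist1 h s s"
  define w where "w = map (\<lambda>i. ((h ^^ i) s, (h ^^ Suc i) s)) [0..<N]"
  have N: "(h ^^ N) s = s" using funpow_dist1_prop[OF so] by (simp add: N_def)
  have V: "V = (\<lambda>i. (h ^^ i) s) ` {0..<N}"
    unfolding s(2) N_def using orbit_conv_funpow_dist1[OF so] .
  have inj: "inj_on (\<lambda>i. (h ^^ i) s) {0..<N}"
    unfolding N_def using inj_on_funpow_dist1[OF so] .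
  have cas: "pre_digraph.cas G s w s"
    using cas_funpow[OF G(1,2), of 0 N h s] N by (simp add: w_def)
  have set_w: "set w = A"
    unfolding A(1) V w_def by (auto simp: image_image)
  \<comment> \<open>\<open>cycle\<close> compares all vertices but the first; these are the
    \<open>h\<close>-images of the distinct iterates.\<close>
  have av: "tl (pre_digraph.awalk_verts G s w) = map h (map (\<lambda>i. (h ^^ i) s) [0..<N])"
    using awalk_verts_funpow[OF G(1,2), of 0 N h s]
    by (simp add: w_def upt_conv_Cons map_Suc_upt[symmetric] del: upt_Suc map_Suc_upt)
  have "inj_on h ((\<lambda>i. (h ^^ i) s) ` {0..<N})" using h(2) V by simp
  then have "distinct (tl (pre_digraph.awalk_verts G s w))"
    unfolding av distinct_map using inj by simp
  moreover have "w \<noteq> []" using set_w A(1) s(1) by auto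
  moreover have "pre_digraph.awalk G s w s"
    unfolding pre_digraph.awalk_def using cas s(1) G(3) set_w A(2) by simp
  ultimately have "pre_digraph.cycle G w"
    unfolding pre_digraph.cycle_def by blast
  moreover have "tail G ` set w = verts G"
    unfolding set_w A(1) G by (simp add: image_image)
  ultimately show ?thesis unfolding Hamilton_cycle_def using set_w by blast
qed

section \<open>The predecessor map of \<open>C n\<close>\<close>

context order_ge_5
begin

text \<open>Sends \<open>p\<close> to the tail of the arc of \<open>C n\<close> entering it; the
  identity elsewhere is what \<open>permutes\<close> asks for.\<close>

definition pred :: "nat list \<Rightarrow> nat list" where
  "pred p = (if p \<in> vertices then if tau_cond n p then tau p else sigma_inv p else p)"

lemma vertices_two:
  assumes "p \<in> vertices"
  obtains a b R where "p = a # b # R"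
  using vertices_length[OF assms] n_ge_5 by (cases p; cases "tl p") auto

lemma tau_vertices:
  assumes "p \<in> vertices"
  shows "tau p \<in> vertices"
proof -
  obtain a b R where "p = a # b # R" using assms by (rule vertices_two)
  then show ?thesis using assms by (auto simp: vertices_iff tau_def)
qed

lemma tau_tau: "p \<in> vertices \<Longrightarrow> tau (tau p) = p"
  by (erule vertices_two[of p]) (auto simp: tau_def)

lemma sigma_sigma_inv: "p \<noteq> [] \<Longrightarrow> sigma (sigma_inv p) = p"
  by (simp add: sigma_def sigma_inv_def)

lemma vertices_not_Nil: "p \<in> vertices \<Longrightarrow> p \<noteq> []"
  using n_ge_5 by (auto simp: vertices_iff)

lemma sigma_inv_vertices:
  assumes "p \<in> vertices"
  shows "sigma_inv p \<in> vertices"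
proof -
  have "mset (sigma_inv p) = mset p"
    using vertices_not_Nil[OF assms] by (cases p rule: rev_cases) (auto simp: sigma_inv_def)
  then show ?thesis
    using assms unfolding vertices_iff by (metis mset_eq_imp_distinct_iff mset_eq_setD)
qed

text \<open>The condition only depends on the first symbol and on the cyclic order of the others; hence
  the two arcs leaving a vertex are never both in \<open>C n\<close>.\<close>

lemma tau_cond_rotate_tail:
  assumes "a # b # R \<in> vertices" "tau_cond n (a # b # R)"
  shows "tau_cond n (a # R @ [b])"
proof -
  have q: "a # R @ [b] \<in> vertices" using assms(1) by (auto simp: vertices_iff)
  have "n \<in> set (a # b # R)" using assms(1) n_ge_5 by (auto simp: vertices_iff)
  then consider "a = n" | "b = n" | X Y where "R = X @ n # Y"
    by (auto dest: split_list)
  then show ?thesis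
  proof cases
    case 1
    then obtain k where "b # R = rotate k [1..<n]"
      using tau_cond_first[of "b # R"] assms by auto
    then have "R @ [b] = rotate (Suc k) [1..<n]" by (metis rotate1.simps(2) rotate_Suc)
    then show ?thesis using tau_cond_first[of "R @ [b]"] q unfolding 1 by blast
  next
    case 2
    obtain c R' where R: "R = c # R'"
      using vertices_length[OF assms(1)] n_ge_5 by (cases R) auto
    then show ?thesis
      using tau_cond_inner[of a "[]" c R'] tau_cond_last[of a c R'] assms q 2 by simp
  next
    case (3 X Y)
    show ?thesis
    proof (cases Y)
      case Nil
      then show ?thesis
        using tau_cond_last[of a b X] tau_cond_inner[of a X b "[]"] assms q 3 by simp
    next
      case (Cons c Y')
      then show ?thesis
        using tau_cond_inner[of a "b # X" c Y'] tau_cond_inner[of a X c "Y' @ [b]"] assms q 3 by simp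
    qed
  qed
qed

text \<open>Equality would make \<open>q\<close> the string \<open>p\<close> with its tail rotated,
  where the condition persists by \<open>tau_cond_rotate_tail\<close>.\<close>

lemma tau_neq_sigma_inv:
  assumes "p \<in> vertices" "q \<in> vertices" "tau_cond n p" "\<not> tau_cond n q"
  shows "tau p \<noteq> sigma_inv q"
proof
  assume eq: "tau p = sigma_inv q"
  obtain a b R where p: "p = a # b # R" using assms(1) by (rule vertices_two)
  have "q = sigma (tau p)" using eq sigma_sigma_inv vertices_not_Nil[OF assms(2)] by simp
  then have "q = a # R @ [b]" using p by (simp add: tau_def sigma_def)
  then show False using tau_cond_rotate_tail assms p by auto
qed

lemma finite_vertices: "finite vertices"
  by (simp add: vertices_def)

lemma pred_vertices: "p \<in> vertices \<Longrightarrow> pred p \<in> vertices"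
  by (simp add: pred_def tau_vertices sigma_inv_vertices)

lemma pred_permutes: "pred permutes vertices"
proof (rule bij_imp_permutes)
  have inj: "inj_on pred vertices"
  proof (rule inj_onI)
    fix p q assume pq: "p \<in> vertices" "q \<in> vertices" "pred p = pred q"
    have "tau_cond n p \<longleftrightarrow> tau_cond n q"
      using tau_neq_sigma_inv[of p q] tau_neq_sigma_inv[of q p] pq
      by (auto simp: pred_def split: if_splits)
    then consider "tau p = tau q" | "sigma_inv p = sigma_inv q"
      using pq by (auto simp: pred_def split: if_splits)
    then show "p = q"
      using tau_tau sigma_sigma_inv vertices_not_Nil pq(1,2) by cases metis+
  qed
  then show "bij_betw pred vertices vertices"
    using finite_vertices pred_vertices by (simp add: bij_betw_def endo_inj_surj image_subsetI)
qed (simp add: pred_def)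

lemma cyclic_on_pred:
  assumes "odd n"
  shows "cyclic_on pred vertices"
proof -
  have perm: "permutation pred" using pred_permutes finite_vertices permutation_permutes by blast
  have step: "orbit pred (pred p) = orbit pred p" for p
    using permutation_orbit_step[OF perm] .
  \<comment> \<open>The invariant is the orbit map itself: it is constant along the arcs, so
    \<open>f_const\<close> makes all orbits equal.\<close>
  interpret vertex_invariant n "orbit pred"
    by unfold_locales (metis step pred_def)+
  let ?s = "place (asc 2) (n - 2)"
  have s: "?s \<in> vertices" using place_vertices asc_words n_ge_5 by simp
  have "p \<in> orbit pred ?s" if "p \<in> vertices" for p
    using permutation_self_in_orbit[OF perm, of p] f_const[OF assms that] by simp
  then have "orbit pred ?s = vertices"
    using permutes_orbit_subset[OF pred_permutes s] by blast
  then show ?thesis unfolding cyclic_on_def using s by blast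
qed

lemma C_eq: "C n = (\<lambda>p. (pred p, p)) ` vertices"
proof -
  have "C n = (\<lambda>p. (if tau_cond n p then tau p else sigma_inv p, p)) ` vertices"
    unfolding C_def vertices_def by blast
  then show ?thesis by (simp add: pred_def cong: image_cong)
qed

lemma arcs_sigma_tau: "(pred p, p) \<in> parcs (sigma_tau_graph n)" if p: "p \<in> vertices"
proof (cases "tau_cond n p")
  case True
  then have "(pred p, p) = (tau p, tau (tau p))" using p tau_tau by (simp add: pred_def)
  then show ?thesis using tau_vertices[OF p] by (auto simp: sigma_tau_graph_def vertices_def)
next
  case False
  then have "(pred p, p) = (sigma_inv p, sigma (sigma_inv p))"
    using p sigma_sigma_inv vertices_not_Nil by (simp add: pred_def)
  then show ?thesis using sigma_inv_vertices[OF p] by (auto simp: sigma_tau_graph_def vertices_def)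
qed

text \<open>\<open>pred\<close> runs against the arcs, so the successor map is
  \<open>inv pred\<close>, which has the same orbits.\<close>

lemma Hamilton_cycle_C:
  assumes "odd n"
  shows "Hamilton_cycle (with_proj (sigma_tau_graph n)) (C n)"
proof (rule Hamilton_cycle_cyclic)
  have perm: "permutation pred" using pred_permutes finite_vertices permutation_permutes by blast
  show "verts (with_proj (sigma_tau_graph n)) = vertices"
    by (simp add: sigma_tau_graph_def vertices_def)
  show "cyclic_on (inv pred) vertices"
    using cyclic_on_pred[OF assms] orbit_inv_eq[OF perm] by (simp add: cyclic_on_def)
  show "inj_on (inv pred) vertices"
    using permutes_inj[OF permutes_inv[OF pred_permutes]] inj_on_subset by blast
  have "C n = (\<lambda>p. (p, inv pred p)) ` pred ` vertices"
    unfolding C_eq image_image using permutes_inverses(2)[OF pred_permutes] by simp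
  then show "C n = (\<lambda>p. (p, inv pred p)) ` vertices"
    using permutes_image[OF pred_permutes] by simp
  show "C n \<subseteq> arcs (with_proj (sigma_tau_graph n))"
    unfolding C_eq using arcs_sigma_tau by auto
qed simp_all

end

theorem theorem21:
  fixes n :: nat
  assumes "n \<ge> 5" and "odd n"
  shows "Hamilton_cycle (with_proj (sigma_tau_graph n)) (C n)"
proof -
  interpret order_ge_5 n by unfold_locales (rule assms(1))
  show ?thesis using assms(2) by (rule Hamilton_cycle_C)
qed

end
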